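(* Let $k$ be an algebraically closed field of characteristic different from $2$ and $3$, let $G$ be a simple algebraic group over $k$ whose root system $\Phi$ is not of type $A_2$, and let $U$ be a maximal unipotent subgroup of $G$. Let $\psi\in\mathrm{Aut}_{\mathrm{alg}}(U)$ and let $y\in U$ be such that $\psi\,\mathrm{Int}_y=\varphi=\varphi_\rho\varphi_\chi\varphi_\omega\varphi_C$, where $\varphi_\rho$ is a graph automorphism, $\varphi_\chi$ a diagonal automorphism, $\varphi_\omega$ an extremal automorphism and $\varphi_C$ a central automorphism of $U$. Let $M(U,\varphi)$ be the block-diagonal matrix associated to $(U,\varphi)$, defined in the context in terms of $\rho$ and $\chi$. Then the following are equivalent: (1) $R(\psi)=1$; (2) $R(\varphi)=1$; (3) the matrix $M(U,\varphi)$ is invertible.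
   Context: Algebraic group: Zariski-closed subgroup of some $\mathrm{GL}_n(k)$. A simple algebraic group is a connected non-commutative algebraic group without nontrivial proper closed connected normal subgroups. $\mathrm{Aut}_{\mathrm{alg}}(U)$ is the group of abstract automorphisms $\varphi$ of $U$ with $\varphi,\varphi^{-1}$ morphisms of varieties; $\mathrm{Int}_y$ is the inner automorphism defined by $y$; $R(\varphi)$ is the number of orbits of the twisted action $(g,x)\mapsto gx\varphi(g^{-1})$ of $U$ on itself. View $G$ as a Chevalley group of type $\Phi$ over $k$ with the usual root elements $x_\alpha(t)$ ($\alpha\in\Phi$, $t\in k$), satisfying $x_\alpha(t)x_\alpha(u)=x_\alpha(t+u)$ and Chevalley's commutator formula $x_\alpha(t)x_\beta(u)=x_\beta(u)x_\alpha(t)\prod_{i,j>0,\ i\alpha+j\beta\in\Phi}x_{i\alpha+j\beta}((-1)^{i+j}c_{ij}t^iu^j)$, with $c_{ij}\in\{\pm1,\pm2,\pm3\}$ depending on $\alpha,\beta$ and the ordering. Let $\Delta=\{\alpha_1,\dots,\alpha_l\}$ be the simple roots and $\Phi^+=\{\alpha_1,\dots,\alpha_N\}$ the positive roots, ordered $\alpha_1<\dots<\alpha_N$ with $\mathrm{ht}(\alpha_i)\le \mathrm{ht}(\alpha_j)$ whenever $\alpha_i<\alpha_j$, where $\mathrm{ht}(\sum n_i\alpha_i)=\sum n_i$; $\alpha_N$ is the unique root of maximal height. Take $U=\langle x_\alpha(t):\alpha\in\Phi^+,t\in k\rangle$; each element of $U$ is uniquely $\prod_{j=1}^N x_{\alpha_j}(t_j)$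 (product in increasing order). If $\Phi$ is of type $A_l$ ($l\ge 2$), there are exactly two simple roots $\alpha_1,\alpha_l$ with $\alpha_N-\alpha_1,\alpha_N-\alpha_l\in\Phi^+$, and the ordering is chosen with $\alpha_{N-2}=\alpha_N-\alpha_l$, $\alpha_{N-1}=\alpha_N-\alpha_1$. If $\Phi$ is not of type $A_l$, there is a unique simple $\alpha_i$ with $\alpha_N-\alpha_i\in\Phi^+$, and $\alpha_{N-1}=\alpha_N-\alpha_i$; if $\Phi$ is of type $C_l$ ($l\ge3$), also $\alpha_N-2\alpha_i\in\Phi^+$ and $\alpha_{N-2}=\alpha_N-2\alpha_i$. Extremal automorphisms: for a simple root $\alpha_i$ with $\alpha_N-\alpha_i\in\Phi^+$ and $u\in k$ there is an automorphism $\varphi_u$ of $U$ fixing $x_{\alpha_j}(t)$ for all $\alpha_j\ne\alpha_i$, with $\varphi_u(x_{\alpha_i}(t))=x_{\alpha_i}(t)x_{\alpha_N-\alpha_i}(ut)x_{\alpha_N}(\lambda_i ut^2)$. If $\Phi$ is of type $C_l$ there is also, for every $u'\in k$, an automorphism $\psi_{u'}$ fixing $x_{\alpha_j}(t)$ for all $\alpha_j\neq\alpha_i$, with $\psi_{u'}(x_{\alpha_i}(t))=x_{\alpha_i}(t)x_{\alpha_N-2\alpha_i}(u't)x_{\alpha_N-\alpha_i}(\mu_iu't^2)x_{\alpha_N}(\nu_iu't^3)$. Here $\lambda_i=\frac12c_{11}$, $\mu_i=\frac12c_{11}$, $\nu_i=\frac13c_{12}$, the integers $c_{ij}$ coming from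 the commutator formula. The extremal automorphisms are the elements of the subgroup of $\mathrm{Aut}_{\mathrm{alg}}(U)$ generated by these automorphisms: they are the $\varphi_u$ ($u\in k$) if $\Phi$ is neither of type $A_l$ nor $C_l$; the products $\varphi_u\varphi_{u'}$ ($u,u'\in k$), with $\varphi_u$ attached to $\alpha_1$ and $\varphi_{u'}$ attached to $\alpha_l$, if $\Phi$ is of type $A_l$, $l\ge3$; the products $\varphi_u\psi_{u'}$ ($u,u'\in k$) if $\Phi$ is of type $C_l$. Central automorphisms: for endomorphisms $g_1,\dots,g_l$ of the additive group of $k$, the map $\varphi_C(\prod_{j=1}^N x_{\alpha_j}(t_j))=\left(\prod_{j=1}^{N-1}x_{\alpha_j}(t_j)\right)x_{\alpha_N}(t_N+\sum_{j=1}^l g_j(t_j))$ is called a central automorphism of $U$. Graph automorphisms: for any symmetry $\rho$ of the Dynkin diagram (acting on $\Phi$), the graph automorphism associated to $\rho$ is the map $\varphi_\rho(\prod_{j=1}^N x_{\alpha_j}(t_j))=\prod_{j=1}^N x_{\rho(\alpha_j)}(t_j)$. Diagonal automorphisms: for a homomorphism $\chi:\mathbb{Z}\langle\Phi\rangle\to k^\times$ from the root lattice, $\varphi_\chi(\prod_{j=1}^N x_{\alpha_j}(t_j))=\prod_{j=1}^N x_{\alpha_j}(\chi(\alpha_j)t_j)$. The matrix $M(U,\varphi)$ for $\varphi=\varphi_\rho\varphi_\chi\varphi_\omega\varphi_C$: for a height $h$, let $\beta_1<\dots<\beta_n$ be all positive roots of height $h$; $\rho$ permutes them, and we write $\rho(\beta_i)=\beta_{\rho(i)}$.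 Define the $n\times n$ matrix $M_h(U,\varphi)=(m_{ij})$ over $k$ as follows. If $\rho(\beta_i)=\beta_i$, then $m_{ii}=\chi(\beta_i)-1$ and $m_{ij}=0$ for all $j\neq i$. If $\rho(i)\ne i$, then $m_{ii}=-1$, $m_{i\rho^{-1}(i)}=\chi(\beta_{\rho^{-1}(i)})$ and $m_{ij}=0$ for all $j\ne i,\rho^{-1}(i)$. If $1=h_1<\dots<h_r$ are all heights of positive roots, $M(U,\varphi)=\mathrm{diag}(M_{h_1}(U,\varphi),\dots,M_{h_r}(U,\varphi))$ (block diagonal).
   Formalization: In type A_1 central automorphisms are taken to be trivial (the sum of the g_j omits α_N), since otherwise x(t)→x(2t) has R=1 but M=(0); and in ν_i the integer c_12 is read with its sign (-1)^{1+2}, without which ψ_{u'} would not exist. *)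

theory Defs
  imports
    "HOL-Analysis.Abstract_Topology"
    "HOL-Analysis.Euclidean_Space"
    "HOL-Algebra.Group_Action"
    "HOL-Algebra.Generated_Groups"
    "HOL-Algebra.Bij"
    "HOL-Library.Nat_Bijection"
    "HOL-Library.Extended_Nat"
    "Jordan_Normal_Form.Determinant"
begin

section \<open>Algebraic groups\<close>

definition GL :: "nat \<Rightarrow> 'k::field mat monoid" where
  "GL n = units_of (ring_mat TYPE('k) n ())"

lemma group_GL: "group (GL n :: 'k::field mat monoid)"
proof -
  have "Group.monoid (ring_mat TYPE('k) n ())"
    using ring_mat[where ?'a = 'k and n = n and b = "()"] by (simp add: Ring.ring_def)
  then show ?thesis
    unfolding GL_def by (rule monoid.units_group)
qed

abbreviation matrix_group :: "nat \<Rightarrow> 'k::field mat set \<Rightarrow> 'k mat monoid" where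
  "matrix_group n H \<equiv> (GL n)\<lparr>carrier := H\<rparr>"

definition mat_prod :: "nat \<Rightarrow> 'k::field mat list \<Rightarrow> 'k mat" where
  "mat_prod n As = foldr (*) As (1\<^sub>m n)"

text \<open>The coordinate ring of \<open>GL n\<close>: polynomials in the matrix entries and the inverse of
  the determinant, as functions (the ground field will be infinite).\<close>

inductive_set regular_functions :: "nat \<Rightarrow> ('k::field mat \<Rightarrow> 'k) set" for n where
  const: "(\<lambda>A. a) \<in> regular_functions n"
| entry: "\<lbrakk>i < n; j < n\<rbrakk> \<Longrightarrow> (\<lambda>A. A $$ (i, j)) \<in> regular_functions n"
| inverse_det: "(\<lambda>A. inverse (det A)) \<in> regular_functions n"
| add: "\<lbrakk>f \<in> regular_functions n; g \<in> regular_functions n\<rbrakk>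
        \<Longrightarrow> (\<lambda>A. f A + g A) \<in> regular_functions n"
| mult: "\<lbrakk>f \<in> regular_functions n; g \<in> regular_functions n\<rbrakk>
        \<Longrightarrow> (\<lambda>A. f A * g A) \<in> regular_functions n"

definition zariski :: "nat \<Rightarrow> 'k::field mat topology" where
  "zariski n = topology (\<lambda>V. \<exists>P \<subseteq> regular_functions n.
     V = {A \<in> carrier (GL n). \<exists>p\<in>P. p A \<noteq> 0})"

lemma istopology_zariski:
  "istopology (\<lambda>V. \<exists>P \<subseteq> regular_functions n.
     V = {A \<in> carrier (GL n). \<exists>p\<in>P. p A \<noteq> (0 :: 'k::field)})"
proof -
  define D where "D P = {A \<in> carrier (GL n). \<exists>p\<in>P. p A \<noteq> 0}" for P :: "('k mat \<Rightarrow> 'k) set"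
  have Int: "\<exists>R \<subseteq> regular_functions n. D P \<inter> D Q = D R"
    if "P \<subseteq> regular_functions n" "Q \<subseteq> regular_functions n" for P Q
  proof (intro exI conjI)
    let ?R = "(\<lambda>(p, q) A. p A * q A) ` (P \<times> Q)"
    show "?R \<subseteq> regular_functions n"
      using that by (auto intro: regular_functions.mult)
    show "D P \<inter> D Q = D ?R"
      by (auto simp: D_def)
  qed
  have Union: "\<exists>R \<subseteq> regular_functions n. \<Union>\<K> = D R"
    if "\<forall>K\<in>\<K>. \<exists>P \<subseteq> regular_functions n. K = D P" for \<K>
  proof -
    from bchoice[OF that] obtain P
      where P: "\<forall>K\<in>\<K>. P K \<subseteq> regular_functions n \<and> K = D (P K)" by blast
    then have "\<Union>\<K> = (\<Union>K\<in>\<K>. D (P K))" by auto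
    also have "\<dots> = D (\<Union>K\<in>\<K>. P K)" by (auto simp: D_def)
    finally show ?thesis using P by (intro exI[of _ "\<Union>K\<in>\<K>. P K"]) auto
  qed
  have "istopology (\<lambda>V. \<exists>P \<subseteq> regular_functions n. V = D P)"
    unfolding istopology_def
  proof (intro conjI allI impI)
    fix S T
    assume "\<exists>P \<subseteq> regular_functions n. S = D P" "\<exists>P \<subseteq> regular_functions n. T = D P"
    then show "\<exists>P \<subseteq> regular_functions n. S \<inter> T = D P"
      by (elim exE conjE) (simp add: Int)
  qed (rule Union)
  then show ?thesis by (simp add: D_def)
qed

lemma openin_zariski:
  "openin (zariski n) V \<longleftrightarrow> (\<exists>P \<subseteq> regular_functions n.
     V = {A \<in> carrier (GL n). \<exists>p\<in>P. p A \<noteq> 0})"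
  unfolding zariski_def by (simp add: topology_inverse'[OF istopology_zariski])

definition closed_subgroup :: "nat \<Rightarrow> 'k::field mat set \<Rightarrow> bool" where
  "closed_subgroup n H \<longleftrightarrow> subgroup H (GL n) \<and> closedin (zariski n) H"

definition simple_algebraic_group :: "nat \<Rightarrow> 'k::field mat set \<Rightarrow> bool" where
  "simple_algebraic_group n G \<longleftrightarrow>
     closed_subgroup n G \<and> connectedin (zariski n) G \<and> \<not> comm_group (matrix_group n G) \<and>
     (\<forall>N. N \<lhd> matrix_group n G \<and> closedin (zariski n) N \<and> connectedin (zariski n) N
        \<longrightarrow> N = {1\<^sub>m n} \<or> N = G)"

definition unipotent_subgroup :: "nat \<Rightarrow> 'k::field mat set \<Rightarrow> bool" where
  "unipotent_subgroup n H \<longleftrightarrow>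
     closed_subgroup n H \<and> (\<forall>A\<in>H. \<exists>m. (A - 1\<^sub>m n) ^\<^sub>m m = 0\<^sub>m n n)"

definition maximal_unipotent_subgroup :: "nat \<Rightarrow> 'k::field mat set \<Rightarrow> 'k mat set \<Rightarrow> bool" where
  "maximal_unipotent_subgroup n G U \<longleftrightarrow>
     unipotent_subgroup n U \<and> U \<subseteq> G \<and>
     (\<forall>V. unipotent_subgroup n V \<and> U \<subseteq> V \<and> V \<subseteq> G \<longrightarrow> V = U)"

definition torus :: "nat \<Rightarrow> 'k::field mat set \<Rightarrow> bool" where
  "torus n T \<longleftrightarrow>
     closed_subgroup n T \<and> connectedin (zariski n) T \<and>
     (\<exists>P \<in> carrier (GL n). \<forall>s\<in>T. diagonal_mat (P * s * inv\<^bsub>GL n\<^esub> P))"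

definition maximal_torus :: "nat \<Rightarrow> 'k::field mat set \<Rightarrow> 'k mat set \<Rightarrow> bool" where
  "maximal_torus n G T \<longleftrightarrow>
     torus n T \<and> T \<subseteq> G \<and> (\<forall>S. torus n S \<and> T \<subseteq> S \<and> S \<subseteq> G \<longrightarrow> S = T)"

definition regular_map_on :: "nat \<Rightarrow> 'k::field mat set \<Rightarrow> ('k mat \<Rightarrow> 'k mat) \<Rightarrow> bool" where
  "regular_map_on n X f \<longleftrightarrow>
     (\<forall>i<n. \<forall>j<n. \<exists>r \<in> regular_functions n. \<forall>A\<in>X. f A $$ (i, j) = r A)"

text \<open>As in \<open>auto\<close>, automorphisms are extensional functions on \<open>U\<close>, so that equality of
  automorphisms is equality of functions.\<close>

definition Aut_alg :: "nat \<Rightarrow> 'k::field mat set \<Rightarrow> ('k mat \<Rightarrow> 'k mat) set" where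
  "Aut_alg n U = {\<phi> \<in> auto (matrix_group n U).
     regular_map_on n U \<phi> \<and> regular_map_on n U (inv_into U \<phi>)}"

definition inner_aut :: "nat \<Rightarrow> 'k::field mat set \<Rightarrow> 'k mat \<Rightarrow> 'k mat \<Rightarrow> 'k mat" where
  "inner_aut n U y = (\<lambda>g\<in>U. y * g * inv\<^bsub>GL n\<^esub> y)"

definition reidemeister_number :: "nat \<Rightarrow> 'k::field mat set \<Rightarrow> ('k mat \<Rightarrow> 'k mat) \<Rightarrow> enat" where
  "reidemeister_number n U \<phi> =
     (let \<O> = orbits (matrix_group n U) U (\<lambda>g x. g * x * \<phi> (inv\<^bsub>GL n\<^esub> g))
      in if finite \<O> then enat (card \<O>) else \<infinity>)"


section \<open>Root systems\<close>

definition cartan :: "'v::euclidean_space \<Rightarrow> 'v \<Rightarrow> real" where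
  "cartan \<alpha> \<beta> = 2 * inner \<alpha> \<beta> / inner \<beta> \<beta>"

definition root_system :: "'v::euclidean_space set \<Rightarrow> bool" where
  "root_system \<Phi> \<longleftrightarrow>
     finite \<Phi> \<and> span \<Phi> = UNIV \<and> 0 \<notin> \<Phi> \<and>
     (\<forall>\<alpha>\<in>\<Phi>. \<forall>a. a *\<^sub>R \<alpha> \<in> \<Phi> \<longrightarrow> a = 1 \<or> a = -1) \<and>
     (\<forall>\<alpha>\<in>\<Phi>. \<forall>\<beta>\<in>\<Phi>. \<beta> - cartan \<beta> \<alpha> *\<^sub>R \<alpha> \<in> \<Phi> \<and> cartan \<beta> \<alpha> \<in> \<int>)"

definition irreducible_root_system :: "'v::euclidean_space set \<Rightarrow> bool" where
  "irreducible_root_system \<Phi> \<longleftrightarrow>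
     root_system \<Phi> \<and>
     (\<nexists>A B. A \<noteq> {} \<and> B \<noteq> {} \<and> A \<inter> B = {} \<and> A \<union> B = \<Phi> \<and> (\<forall>\<alpha>\<in>A. \<forall>\<beta>\<in>B. inner \<alpha> \<beta> = 0))"

definition root_lattice :: "'v::euclidean_space set \<Rightarrow> 'v set" where
  "root_lattice \<Phi> = {\<Sum>\<alpha>\<in>\<Phi>. of_int (m \<alpha>) *\<^sub>R \<alpha> | m. True}"

definition simple_roots :: "'v::euclidean_space set \<Rightarrow> 'v set \<Rightarrow> bool" where
  "simple_roots \<Phi> \<Delta> \<longleftrightarrow>
     \<Delta> \<subseteq> \<Phi> \<and> independent \<Delta> \<and> span \<Delta> = UNIV \<and>
     (\<forall>\<alpha>\<in>\<Phi>. (\<forall>\<delta>\<in>\<Delta>. representation \<Delta> \<alpha> \<delta> \<in> \<nat>) \<or> (\<forall>\<delta>\<in>\<Delta>. - representation \<Delta> \<alpha> \<delta> \<in> \<nat>))"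

definition positive_roots :: "'v::euclidean_space set \<Rightarrow> 'v set \<Rightarrow> 'v set" where
  "positive_roots \<Phi> \<Delta> = {\<alpha> \<in> \<Phi>. \<forall>\<delta>\<in>\<Delta>. representation \<Delta> \<alpha> \<delta> \<ge> 0}"

definition ht :: "'v::euclidean_space set \<Rightarrow> 'v \<Rightarrow> real" where
  "ht \<Delta> \<alpha> = (\<Sum>\<delta>\<in>\<Delta>. representation \<Delta> \<alpha> \<delta>)"

definition type_A :: "nat \<Rightarrow> 'v::euclidean_space set \<Rightarrow> bool" where
  "type_A l \<Delta> \<longleftrightarrow>
     (\<exists>ds. distinct ds \<and> set ds = \<Delta> \<and> length ds = l \<and>
        (\<forall>i<l. \<forall>j<l. cartan (ds ! i) (ds ! j) =
           (if i = j then 2 else if i = Suc j \<or> j = Suc i then -1 else 0)))"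

text \<open>The last simple root is the long one.\<close>

definition type_C :: "nat \<Rightarrow> 'v::euclidean_space set \<Rightarrow> bool" where
  "type_C l \<Delta> \<longleftrightarrow>
     (\<exists>ds. distinct ds \<and> set ds = \<Delta> \<and> length ds = l \<and>
        (\<forall>i<l. \<forall>j<l. cartan (ds ! i) (ds ! j) =
           (if i = j then 2
            else if i = Suc j \<and> i = l - 1 then -2
            else if i = Suc j \<or> j = Suc i then -1 else 0)))"

text \<open>Enumerations \<open>\<alpha>\<^sub>1 < \<dots> < \<alpha>\<^sub>N\<close> of the positive roots; the entries of the list are
  numbered from \<open>0\<close>. The simple roots, having height \<open>1\<close>, come first.\<close>

definition root_ordering :: "'v::euclidean_space set \<Rightarrow> 'v set \<Rightarrow> 'v list \<Rightarrow> bool" where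
  "root_ordering \<Phi> \<Delta> rs \<longleftrightarrow>
     (let N = length rs; \<alpha>\<^sub>N = last rs in
       distinct rs \<and> set rs = positive_roots \<Phi> \<Delta> \<and>
       sorted_wrt (\<lambda>\<alpha> \<beta>. ht \<Delta> \<alpha> \<le> ht \<Delta> \<beta>) rs \<and>
       (\<forall>l\<ge>2. type_A l \<Delta> \<longrightarrow>
          rs ! (N - 3) = \<alpha>\<^sub>N - rs ! (l - 1) \<and> rs ! (N - 2) = \<alpha>\<^sub>N - rs ! 0) \<and>
       ((\<forall>l. \<not> type_A l \<Delta>) \<longrightarrow>
          (\<forall>\<alpha>\<in>\<Delta>. \<alpha>\<^sub>N - \<alpha> \<in> positive_roots \<Phi> \<Delta> \<longrightarrow> rs ! (N - 2) = \<alpha>\<^sub>N - \<alpha>)) \<and>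
       (\<forall>l\<ge>3. type_C l \<Delta> \<longrightarrow>
          (\<forall>\<alpha>\<in>\<Delta>. \<alpha>\<^sub>N - \<alpha> \<in> positive_roots \<Phi> \<Delta> \<longrightarrow> rs ! (N - 3) = \<alpha>\<^sub>N - 2 *\<^sub>R \<alpha>)))"


section \<open>Simple algebraic groups as Chevalley groups\<close>

text \<open>The root system is realised on the maximal torus \<open>T\<close> by \<open>ev\<close>, which embeds the root
  lattice into the character group of \<open>T\<close>.\<close>

definition root_characters ::
  "nat \<Rightarrow> 'k::field mat set \<Rightarrow> 'v::euclidean_space set \<Rightarrow> ('v \<Rightarrow> 'k mat \<Rightarrow> 'k) \<Rightarrow> bool" where
  "root_characters n T \<Phi> ev \<longleftrightarrow>
     (\<forall>\<alpha> \<in> root_lattice \<Phi>.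
        (\<exists>r \<in> regular_functions n. \<forall>s\<in>T. ev \<alpha> s = r s) \<and>
        (\<forall>s\<in>T. ev \<alpha> s \<noteq> 0) \<and>
        (\<forall>s\<in>T. \<forall>s'\<in>T. ev \<alpha> (s * s') = ev \<alpha> s * ev \<alpha> s') \<and>
        ((\<forall>s\<in>T. ev \<alpha> s = 1) \<longrightarrow> \<alpha> = 0)) \<and>
     (\<forall>\<alpha> \<in> root_lattice \<Phi>. \<forall>\<beta> \<in> root_lattice \<Phi>. \<forall>s\<in>T. ev (\<alpha> + \<beta>) s = ev \<alpha> s * ev \<beta> s)"

definition weyl_elt :: "('v::euclidean_space \<Rightarrow> 'k::field \<Rightarrow> 'k mat) \<Rightarrow> 'v \<Rightarrow> 'k \<Rightarrow> 'k mat" where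
  "weyl_elt x \<alpha> t = x \<alpha> t * x (- \<alpha>) (- inverse t) * x \<alpha> t"

definition torus_elt :: "('v::euclidean_space \<Rightarrow> 'k::field \<Rightarrow> 'k mat) \<Rightarrow> 'v \<Rightarrow> 'k \<Rightarrow> 'k mat" where
  "torus_elt x \<alpha> t = weyl_elt x \<alpha> t * weyl_elt x \<alpha> (-1)"

text \<open>The pairs \<open>i, j > 0\<close> with \<open>i\<alpha> + j\<beta> \<in> \<Phi>\<close>, ordered by increasing \<open>i + j\<close> (and then by
  \<open>i\<close>), which is the order of \<open>prod_encode\<close>. This is the order of the factors in Chevalley's
  commutator formula.\<close>

definition commutator_pairs :: "'v::euclidean_space set \<Rightarrow> 'v \<Rightarrow> 'v \<Rightarrow> (nat \<times> nat) list" where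
  "commutator_pairs \<Phi> \<alpha> \<beta> =
     map prod_decode (sorted_list_of_set
       (prod_encode ` {(i, j). i > 0 \<and> j > 0 \<and> real i *\<^sub>R \<alpha> + real j *\<^sub>R \<beta> \<in> \<Phi>}))"

definition commutator_coeff ::
  "('v::euclidean_space \<Rightarrow> 'v \<Rightarrow> nat \<Rightarrow> nat \<Rightarrow> int) \<Rightarrow> 'v \<Rightarrow> 'v \<Rightarrow> nat \<Rightarrow> nat \<Rightarrow> 'k::field" where
  "commutator_coeff c \<alpha> \<beta> i j = of_int ((-1) ^ (i + j) * c \<alpha> \<beta> i j)"

definition chevalley_group ::
  "nat \<Rightarrow> 'k::field mat set \<Rightarrow> 'k mat set \<Rightarrow> 'v::euclidean_space set \<Rightarrow> ('v \<Rightarrow> 'k mat \<Rightarrow> 'k) \<Rightarrow>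
   ('v \<Rightarrow> 'k \<Rightarrow> 'k mat) \<Rightarrow> ('v \<Rightarrow> 'v \<Rightarrow> nat \<Rightarrow> nat \<Rightarrow> int) \<Rightarrow> bool" where
  "chevalley_group n G T \<Phi> ev x c \<longleftrightarrow>
     irreducible_root_system \<Phi> \<and> maximal_torus n G T \<and> root_characters n T \<Phi> ev \<and>
     G = generate (GL n) {x \<alpha> t | \<alpha> t. \<alpha> \<in> \<Phi>} \<and>
     \<comment> \<open>each \<open>x \<alpha>\<close> is an isomorphism of algebraic groups from the additive group to its image\<close>
     (\<forall>\<alpha>\<in>\<Phi>. \<forall>t u. x \<alpha> (t + u) = x \<alpha> t * x \<alpha> u) \<and>
     (\<forall>\<alpha>\<in>\<Phi>. \<forall>i<n. \<forall>j<n. \<exists>p. \<forall>t. x \<alpha> t $$ (i, j) = poly p t) \<and>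
     (\<forall>\<alpha>\<in>\<Phi>. \<exists>r \<in> regular_functions n. \<forall>t. r (x \<alpha> t) = t) \<and>
     (\<forall>\<alpha>\<in>\<Phi>. \<forall>s\<in>T. \<forall>t. s * x \<alpha> t * inv\<^bsub>GL n\<^esub> s = x \<alpha> (ev \<alpha> s * t)) \<and>
     (\<forall>\<alpha>\<in>\<Phi>. \<forall>t. t \<noteq> 0 \<longrightarrow> torus_elt x \<alpha> t \<in> T \<and>
        (\<forall>\<beta>\<in>\<Phi>. ev \<beta> (torus_elt x \<alpha> t) = t powi \<lfloor>cartan \<beta> \<alpha>\<rfloor>)) \<and>
     \<comment> \<open>Chevalley's commutator formula\<close>
     (\<forall>\<alpha>\<in>\<Phi>. \<forall>\<beta>\<in>\<Phi>. \<beta> \<noteq> - \<alpha> \<longrightarrow>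
        (\<forall>i>0. \<forall>j>0. real i *\<^sub>R \<alpha> + real j *\<^sub>R \<beta> \<in> \<Phi> \<longrightarrow> \<bar>c \<alpha> \<beta> i j\<bar> \<in> {1, 2, 3}) \<and>
        (\<forall>t u. x \<alpha> t * x \<beta> u = x \<beta> u * x \<alpha> t *
           mat_prod n (map (\<lambda>(i, j). x (real i *\<^sub>R \<alpha> + real j *\<^sub>R \<beta>)
                                       (commutator_coeff c \<alpha> \<beta> i j * t ^ i * u ^ j))
                           (commutator_pairs \<Phi> \<alpha> \<beta>))))"

definition root_product ::
  "nat \<Rightarrow> ('v \<Rightarrow> 'k \<Rightarrow> 'k::field mat) \<Rightarrow> 'v list \<Rightarrow> ('v \<Rightarrow> 'k) \<Rightarrow> 'k mat" where
  "root_product n x rs t = mat_prod n (map (\<lambda>\<alpha>. x \<alpha> (t \<alpha>)) rs)"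

text \<open>\<open>U\<close> is generated by the positive root elements, and its elements are uniquely the products
  of positive root elements in increasing order.\<close>

definition positive_unipotent ::
  "nat \<Rightarrow> ('v::euclidean_space \<Rightarrow> 'k \<Rightarrow> 'k::field mat) \<Rightarrow> 'v list \<Rightarrow> 'k mat set \<Rightarrow> bool" where
  "positive_unipotent n x rs U \<longleftrightarrow>
     U = generate (GL n) {x \<alpha> t | \<alpha> t. \<alpha> \<in> set rs} \<and>
     bij_betw (root_product n x rs) (set rs \<rightarrow>\<^sub>E UNIV) U"


section \<open>Automorphisms of the maximal unipotent subgroup\<close>

definition diagram_symmetry ::
  "'v::euclidean_space set \<Rightarrow> 'v set \<Rightarrow> ('v \<Rightarrow> 'v) \<Rightarrow> bool" where
  "diagram_symmetry \<Phi> \<Delta> \<rho> \<longleftrightarrow>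
     linear \<rho> \<and> \<rho> ` \<Delta> = \<Delta> \<and> \<rho> ` \<Phi> = \<Phi> \<and>
     (\<forall>\<alpha>\<in>\<Delta>. \<forall>\<beta>\<in>\<Delta>. cartan (\<rho> \<alpha>) (\<rho> \<beta>) = cartan \<alpha> \<beta>)"

definition graph_automorphism ::
  "nat \<Rightarrow> ('v \<Rightarrow> 'k \<Rightarrow> 'k::field mat) \<Rightarrow> 'v list \<Rightarrow> 'k mat set \<Rightarrow> ('v \<Rightarrow> 'v) \<Rightarrow>
   ('k mat \<Rightarrow> 'k mat) \<Rightarrow> bool" where
  "graph_automorphism n x rs U \<rho> f \<longleftrightarrow>
     f \<in> extensional U \<and>
     (\<forall>t. f (root_product n x rs t) = mat_prod n (map (\<lambda>\<alpha>. x (\<rho> \<alpha>) (t \<alpha>)) rs))"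

definition lattice_hom :: "'v::euclidean_space set \<Rightarrow> ('v \<Rightarrow> 'k::field) \<Rightarrow> bool" where
  "lattice_hom \<Phi> \<chi> \<longleftrightarrow>
     (\<forall>\<alpha> \<in> root_lattice \<Phi>. \<chi> \<alpha> \<noteq> 0) \<and>
     (\<forall>\<alpha> \<in> root_lattice \<Phi>. \<forall>\<beta> \<in> root_lattice \<Phi>. \<chi> (\<alpha> + \<beta>) = \<chi> \<alpha> * \<chi> \<beta>)"

definition diagonal_automorphism ::
  "nat \<Rightarrow> ('v \<Rightarrow> 'k \<Rightarrow> 'k::field mat) \<Rightarrow> 'v list \<Rightarrow> 'k mat set \<Rightarrow> ('v \<Rightarrow> 'k) \<Rightarrow>
   ('k mat \<Rightarrow> 'k mat) \<Rightarrow> bool" where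
  "diagonal_automorphism n x rs U \<chi> f \<longleftrightarrow>
     f \<in> extensional U \<and>
     (\<forall>t. f (root_product n x rs t) = root_product n x rs (\<lambda>\<alpha>. \<chi> \<alpha> * t \<alpha>))"

text \<open>The sum omits \<open>\<alpha>\<^sub>N\<close>, which matters only in rank one, where \<open>\<alpha>\<^sub>N\<close> is itself simple
  and \<open>t \<mapsto> t + g t\<close> would not be a central automorphism but a rescaling of the additive group
  (which is diagonal) or no automorphism at all.\<close>

definition central_automorphism ::
  "nat \<Rightarrow> ('v \<Rightarrow> 'k \<Rightarrow> 'k::field mat) \<Rightarrow> 'v set \<Rightarrow> 'v list \<Rightarrow> 'k mat set \<Rightarrow>
   ('k mat \<Rightarrow> 'k mat) \<Rightarrow> bool" where
  "central_automorphism n x \<Delta> rs U f \<longleftrightarrow>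
     f \<in> extensional U \<and>
     (\<exists>g. (\<forall>\<alpha>\<in>\<Delta>. \<forall>a b. g \<alpha> (a + b) = g \<alpha> a + g \<alpha> b) \<and>
        (\<forall>t. f (root_product n x rs t) =
           root_product n x rs (t(last rs := t (last rs) + (\<Sum>\<alpha> \<in> \<Delta> - {last rs}. g \<alpha> (t \<alpha>))))))"

text \<open>The automorphisms \<open>\<phi>\<^sub>u\<close>. With \<open>\<gamma> = \<alpha>\<^sub>N - \<alpha>\<close>, moving \<open>x \<alpha> t'\<close> past \<open>x \<gamma> (u t)\<close> shows that the
  coefficient \<open>l\<close>, usually written \<open>\<lambda>\<close>, is half the coefficient \<open>c\<^sub>1\<^sub>1\<close> of the commutator formula for the pair
  \<open>\<gamma>, \<alpha>\<close>.\<close>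

definition extremal_phi ::
  "nat \<Rightarrow> 'v::euclidean_space set \<Rightarrow> 'v set \<Rightarrow> ('v \<Rightarrow> 'k \<Rightarrow> 'k::field mat) \<Rightarrow>
   ('v \<Rightarrow> 'v \<Rightarrow> nat \<Rightarrow> nat \<Rightarrow> int) \<Rightarrow> 'v list \<Rightarrow> 'k mat set \<Rightarrow> ('k mat \<Rightarrow> 'k mat) set" where
  "extremal_phi n \<Phi> \<Delta> x c rs U = {f \<in> Aut_alg n U. \<exists>\<alpha>\<in>\<Delta>. \<exists>u.
     let \<alpha>\<^sub>N = last rs; \<gamma> = \<alpha>\<^sub>N - \<alpha>; l = commutator_coeff c \<gamma> \<alpha> 1 1 / 2 in
     \<gamma> \<in> positive_roots \<Phi> \<Delta> \<and>
     (\<forall>\<beta>\<in>positive_roots \<Phi> \<Delta> - {\<alpha>}. \<forall>t. f (x \<beta> t) = x \<beta> t) \<and>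
     (\<forall>t. f (x \<alpha> t) = x \<alpha> t * x \<gamma> (u * t) * x \<alpha>\<^sub>N (l * u * t ^ 2))}"

text \<open>The automorphisms \<open>\<psi>\<^sub>u\<close> in type \<open>C\<^sub>l\<close>. With \<open>\<gamma> = \<alpha>\<^sub>N - \<alpha>\<close> and \<open>\<delta> = \<alpha>\<^sub>N - 2\<alpha>\<close>, additivity
  in \<open>t\<close> forces \<open>\<mu>\<close> and \<open>\<nu>\<close> to be \<open>1/2\<close> and \<open>1/3\<close> of the coefficients with which \<open>t u\<close> and
  \<open>t u\<^sup>2\<close> occur in the commutator formula for the pair \<open>\<delta>, \<alpha>\<close>; for \<open>\<nu>\<close> this includes the sign
  \<open>(-1)\<^sup>1\<^sup>+\<^sup>2\<close>.\<close>

definition extremal_psi ::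
  "nat \<Rightarrow> 'v::euclidean_space set \<Rightarrow> 'v set \<Rightarrow> ('v \<Rightarrow> 'k \<Rightarrow> 'k::field mat) \<Rightarrow>
   ('v \<Rightarrow> 'v \<Rightarrow> nat \<Rightarrow> nat \<Rightarrow> int) \<Rightarrow> 'v list \<Rightarrow> 'k mat set \<Rightarrow> ('k mat \<Rightarrow> 'k mat) set" where
  "extremal_psi n \<Phi> \<Delta> x c rs U = {f \<in> Aut_alg n U. \<exists>\<alpha>\<in>\<Delta>. \<exists>u.
     let \<alpha>\<^sub>N = last rs; \<gamma> = \<alpha>\<^sub>N - \<alpha>; \<delta> = \<alpha>\<^sub>N - 2 *\<^sub>R \<alpha>;
         \<mu> = commutator_coeff c \<delta> \<alpha> 1 1 / 2; \<nu> = commutator_coeff c \<delta> \<alpha> 1 2 / 3 in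
     (\<exists>l\<ge>3. type_C l \<Delta>) \<and>
     \<gamma> \<in> positive_roots \<Phi> \<Delta> \<and> \<delta> \<in> positive_roots \<Phi> \<Delta> \<and>
     (\<forall>\<beta>\<in>positive_roots \<Phi> \<Delta> - {\<alpha>}. \<forall>t. f (x \<beta> t) = x \<beta> t) \<and>
     (\<forall>t. f (x \<alpha> t) =
        x \<alpha> t * x \<delta> (u * t) * x \<gamma> (\<mu> * u * t ^ 2) * x \<alpha>\<^sub>N (\<nu> * u * t ^ 3))}"

definition extremal_automorphisms ::
  "nat \<Rightarrow> 'v::euclidean_space set \<Rightarrow> 'v set \<Rightarrow> ('v \<Rightarrow> 'k \<Rightarrow> 'k::field mat) \<Rightarrow>
   ('v \<Rightarrow> 'v \<Rightarrow> nat \<Rightarrow> nat \<Rightarrow> int) \<Rightarrow> 'v list \<Rightarrow> 'k mat set \<Rightarrow> ('k mat \<Rightarrow> 'k mat) set" where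
  "extremal_automorphisms n \<Phi> \<Delta> x c rs U =
     generate (AutoGroup (matrix_group n U))
       (extremal_phi n \<Phi> \<Delta> x c rs U \<union> extremal_psi n \<Phi> \<Delta> x c rs U)"


section \<open>The matrix associated to an automorphism\<close>

text \<open>In the off-diagonal case, the condition \<open>\<rho> (\<beta> ! j) = \<beta> ! i\<close> says \<open>j = \<rho>\<^sup>-\<^sup>1(i)\<close>.\<close>

definition height_matrix ::
  "'v::euclidean_space set \<Rightarrow> 'v list \<Rightarrow> ('v \<Rightarrow> 'v) \<Rightarrow> ('v \<Rightarrow> 'k::field) \<Rightarrow> real \<Rightarrow> 'k mat" where
  "height_matrix \<Delta> rs \<rho> \<chi> h =
     (let \<beta> = filter (\<lambda>\<alpha>. ht \<Delta> \<alpha> = h) rs; m = length \<beta> in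
      mat m m (\<lambda>(i, j).
        if \<rho> (\<beta> ! i) = \<beta> ! i then (if j = i then \<chi> (\<beta> ! i) - 1 else 0)
        else if j = i then -1
        else if \<rho> (\<beta> ! j) = \<beta> ! i then \<chi> (\<beta> ! j)
        else 0))"

definition automorphism_matrix ::
  "'v::euclidean_space set \<Rightarrow> 'v list \<Rightarrow> ('v \<Rightarrow> 'v) \<Rightarrow> ('v \<Rightarrow> 'k::field) \<Rightarrow> 'k mat" where
  "automorphism_matrix \<Delta> rs \<rho> \<chi> =
     diag_block_mat (map (height_matrix \<Delta> rs \<rho> \<chi>) (sorted_list_of_set (ht \<Delta> ` set rs)))"

end

theory Submission
  imports Defs
begin

text \<open>
  Filter \<open>U\<close> by the subgroups \<open>V h\<close> generated by the root elements of height at least \<open>h\<close>. By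
  Chevalley's commutator formula \<open>V h / V (h + 1)\<close> is central in \<open>U / V (h + 1)\<close>, and by uniqueness of
  coordinates it is a vector space with one coordinate per root of height \<open>h\<close>. Central and extremal
  automorphisms act trivially on every layer, because outside type \<open>A\<^sub>2\<close> the roots \<open>\<alpha>\<^sub>N - \<alpha>\<^sub>i\<close> and
  \<open>\<alpha>\<^sub>N - 2\<alpha>\<^sub>i\<close> occurring in them are not simple. Hence \<open>\<phi>\<close> acts on a layer through \<open>\<rho>\<close> and \<open>\<chi>\<close>
  only, as \<open>1 + M\<^sub>h\<close>. If all \<open>M\<^sub>h\<close> are invertible, every element can be moved to \<open>1\<close> layer by layer.
  Conversely, if \<open>\<phi>\<close> has a single twisted class and \<open>M\<^sub>j\<close> is injective for all \<open>j < h\<close>, then only elements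
  \<open>g \<in> V h\<close> satisfy \<open>g \<phi>(g)\<^sup>-\<^sup>1 \<in> V h\<close>, so \<open>M\<^sub>h\<close> is surjective. Finally \<open>R(\<psi>) = R(\<psi> Int\<^sub>y)\<close>, since twisting by
  an inner automorphism only translates the classes.
\<close>

section \<open>Root systems\<close>

text \<open>Graph, diagonal and central automorphisms are given by coordinate formulas alone,
  without a multiplicativity hypothesis. So \<phi> is recognised as an endomorphism from its other
  expression, \<psi> followed after \<open>Int\<^sub>y\<close>, and its four factors serve only to
  compute the leading term of the image of each root element. A coordinate formula can be evaluated
  at x(t) w only if the coordinates of that whole product are controlled; therefore leading terms
  are followed through entire cosets of the filtration and not just through root elements. The
  obstacle on the side of root systems is to show that the roots introduced by extremal
  automorphisms have height at least 2. This rests on the fact that the highest root involves every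
  simple root, which is derived here from irreducibility through dominance and the connectedness of
  the simple roots. In the converse direction surjectivity of a square matrix yields its
  injectivity, and this is what gives access to the next layer.\<close>

lemma sum_in_Nats:
  fixes f :: "'i \<Rightarrow> 'a::semiring_1"
  shows "(\<And>i. i \<in> A \<Longrightarrow> f i \<in> \<nat>) \<Longrightarrow> sum f A \<in> \<nat>"
  by (induction A rule: infinite_finite_induct) auto

locale based_root_system =
  fixes \<Phi> \<Delta> :: "'v::euclidean_space set"
  assumes irreducible: "irreducible_root_system \<Phi>"
    and simple: "simple_roots \<Phi> \<Delta>"
begin

abbreviation coeff :: "'v \<Rightarrow> 'v \<Rightarrow> real" where
  "coeff \<equiv> representation \<Delta>"

lemma independent_simple: "independent \<Delta>" and span_simple: "span \<Delta> = UNIV"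
  and simple_in_roots: "\<delta> \<in> \<Delta> \<Longrightarrow> \<delta> \<in> \<Phi>"
  using simple by (auto simp: simple_roots_def)

lemma finite_simple: "finite \<Delta>"
  using independent_simple by (rule finiteI_independent)

lemma coeff_nat_or_neg:
  "\<alpha> \<in> \<Phi> \<Longrightarrow> (\<forall>\<delta>\<in>\<Delta>. coeff \<alpha> \<delta> \<in> \<nat>) \<or> (\<forall>\<delta>\<in>\<Delta>. - coeff \<alpha> \<delta> \<in> \<nat>)"
  using simple by (auto simp: simple_roots_def)

lemma coeff_expansion: "(\<Sum>\<delta>\<in>\<Delta>. coeff v \<delta> *\<^sub>R \<delta>) = v"
  by (rule real_vector.sum_representation_eq) (auto simp: independent_simple span_simple finite_simple)

lemma coeff_add: "coeff (u + v) \<delta> = coeff u \<delta> + coeff v \<delta>"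
  and coeff_diff: "coeff (u - v) \<delta> = coeff u \<delta> - coeff v \<delta>"
  and coeff_neg: "coeff (- v) \<delta> = - coeff v \<delta>"
  and coeff_scale: "coeff (a *\<^sub>R v) \<delta> = a * coeff v \<delta>"
  using real_vector.representation_add[OF independent_simple, of v u]
    real_vector.representation_diff[OF independent_simple, of v u]
    real_vector.representation_neg[OF independent_simple, of v]
    real_vector.representation_scale[OF independent_simple, of v a]
  by (auto simp: span_simple)

lemma coeff_simple: "\<alpha> \<in> \<Delta> \<Longrightarrow> coeff \<alpha> \<delta> = (if \<delta> = \<alpha> then 1 else 0)"
  using real_vector.representation_basis[OF independent_simple, of \<alpha>] by auto

lemma ht_linear:
  "ht \<Delta> (u + v) = ht \<Delta> u + ht \<Delta> v" "ht \<Delta> (u - v) = ht \<Delta> u - ht \<Delta> v"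
  "ht \<Delta> (a *\<^sub>R v) = a * ht \<Delta> v"
  by (auto simp: ht_def coeff_add coeff_diff coeff_scale sum.distrib sum_subtractf sum_distrib_left)

lemma ht_simple: "\<alpha> \<in> \<Delta> \<Longrightarrow> ht \<Delta> \<alpha> = 1"
  by (simp add: ht_def coeff_simple finite_simple)

lemma roots_finite: "finite \<Phi>" and zero_not_root: "0 \<notin> \<Phi>"
  and reduced: "\<alpha> \<in> \<Phi> \<Longrightarrow> a *\<^sub>R \<alpha> \<in> \<Phi> \<Longrightarrow> a = 1 \<or> a = -1"
  and reflection: "\<alpha> \<in> \<Phi> \<Longrightarrow> \<beta> \<in> \<Phi> \<Longrightarrow> \<beta> - cartan \<beta> \<alpha> *\<^sub>R \<alpha> \<in> \<Phi>"
  and cartan_int: "\<alpha> \<in> \<Phi> \<Longrightarrow> \<beta> \<in> \<Phi> \<Longrightarrow> cartan \<beta> \<alpha> \<in> \<int>"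
  using irreducible unfolding irreducible_root_system_def root_system_def by blast+

lemma cartan_self: "\<alpha> \<noteq> 0 \<Longrightarrow> cartan \<alpha> \<alpha> = 2"
  by (simp add: cartan_def)

lemma cartan_linear:
  "cartan (u + v) \<alpha> = cartan u \<alpha> + cartan v \<alpha>"
  "cartan (u - v) \<alpha> = cartan u \<alpha> - cartan v \<alpha>"
  "cartan (a *\<^sub>R v) \<alpha> = a * cartan v \<alpha>"
  by (simp_all add: cartan_def inner_add_left inner_diff_left add_divide_distrib diff_divide_distrib algebra_simps)

lemma uminus_root: "\<alpha> \<in> \<Phi> \<Longrightarrow> - \<alpha> \<in> \<Phi>"
  using reflection[of \<alpha> \<alpha>] zero_not_root cartan_self[of \<alpha>] by (cases "\<alpha> = 0") (auto simp: scaleR_2)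

lemma positive_root: "\<alpha> \<in> positive_roots \<Phi> \<Delta> \<Longrightarrow> \<alpha> \<in> \<Phi>"
  by (simp add: positive_roots_def)

lemma positive_coeff_nat:
  assumes "\<alpha> \<in> positive_roots \<Phi> \<Delta>" "\<delta> \<in> \<Delta>"
  shows "coeff \<alpha> \<delta> \<in> \<nat>"
proof -
  have "coeff \<alpha> \<delta> \<ge> 0" "\<alpha> \<in> \<Phi>" using assms by (auto simp: positive_roots_def)
  moreover have "r = 0" if "r \<ge> 0" "- r \<in> \<nat>" for r :: real
    using that by (auto simp: Nats_def)
  ultimately show ?thesis using coeff_nat_or_neg[of \<alpha>] assms(2) by force
qed

text \<open>The coefficients of a root never have opposite signs, so one positive coefficient
  decides. This is how reflected roots are recognised as positive below.\<close>

lemma positiveI: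
  assumes "\<alpha> \<in> \<Phi>" "\<delta> \<in> \<Delta>" "coeff \<alpha> \<delta> > 0"
  shows "\<alpha> \<in> positive_roots \<Phi> \<Delta>"
proof -
  have "\<not> - coeff \<alpha> \<delta> \<in> \<nat>" using assms(3) by (auto simp: Nats_def)
  then have "\<forall>\<delta>\<in>\<Delta>. coeff \<alpha> \<delta> \<in> \<nat>" using coeff_nat_or_neg[OF assms(1)] assms(2) by blast
  then show ?thesis using assms(1) by (auto simp: positive_roots_def Nats_def)
qed

lemma no_mixed_signs:
  assumes "\<alpha> \<in> \<Phi>" "\<delta> \<in> \<Delta>" "coeff \<alpha> \<delta> > 0" "\<epsilon> \<in> \<Delta>"
  shows "coeff \<alpha> \<epsilon> \<ge> 0"
  using positiveI[OF assms(1-3)] assms(4) by (simp add: positive_roots_def)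

lemma simple_positive: "\<delta> \<in> \<Delta> \<Longrightarrow> \<delta> \<in> positive_roots \<Phi> \<Delta>"
  by (rule positiveI[of _ \<delta>]) (auto simp: simple_in_roots coeff_simple)

lemma root_pos_or_neg: "\<alpha> \<in> \<Phi> \<Longrightarrow> \<alpha> \<in> positive_roots \<Phi> \<Delta> \<or> - \<alpha> \<in> positive_roots \<Phi> \<Delta>"
  using coeff_nat_or_neg[of \<alpha>] uminus_root[of \<alpha>]
  by (force simp: positive_roots_def coeff_neg Nats_def)

lemma positive_ht_nat:
  assumes "\<alpha> \<in> positive_roots \<Phi> \<Delta>"
  obtains m where "ht \<Delta> \<alpha> = real m" "m > 0"
proof -
  have "ht \<Delta> \<alpha> \<in> \<nat>" unfolding ht_def
    using positive_coeff_nat[OF assms] by (rule sum_in_Nats)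
  then obtain m where m: "ht \<Delta> \<alpha> = real m" by (auto simp: Nats_def)
  have "m \<noteq> 0"
  proof
    assume "m = 0"
    then have "\<forall>\<delta>\<in>\<Delta>. coeff \<alpha> \<delta> = 0"
      using m assms by (simp add: ht_def sum_nonneg_eq_0_iff[OF finite_simple] positive_roots_def)
    then have "\<alpha> = 0" using coeff_expansion[of \<alpha>] by simp
    then show False using positive_root[OF assms] zero_not_root by simp
  qed
  then show thesis using m that by simp
qed

text \<open>Natural numbers with sum 1 all vanish except for a single 1.\<close>

lemma ht_one_simple:
  assumes "\<alpha> \<in> positive_roots \<Phi> \<Delta>" "ht \<Delta> \<alpha> = 1"
  shows "\<alpha> \<in> \<Delta>"
proof -
  have nn: "coeff \<alpha> \<delta> \<ge> 0" if "\<delta> \<in> \<Delta>" for \<delta> using assms(1) that by (simp add: positive_roots_def)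
  have "\<exists>\<delta>\<in>\<Delta>. coeff \<alpha> \<delta> \<noteq> 0"
  proof (rule ccontr)
    assume "\<not> ?thesis" then have "ht \<Delta> \<alpha> = 0" by (simp add: ht_def)
    then show False using assms(2) by simp
  qed
  then obtain \<delta> where d: "\<delta> \<in> \<Delta>" "coeff \<alpha> \<delta> \<noteq> 0" by blast
  then have ge: "coeff \<alpha> \<delta> \<ge> 1" using positive_coeff_nat[OF assms(1) d(1)] by (auto simp: Nats_def)
  have split: "coeff \<alpha> \<delta> + (\<Sum>\<epsilon>\<in>\<Delta>-{\<delta>}. coeff \<alpha> \<epsilon>) = 1"
    using assms(2) sum.remove[OF finite_simple d(1), of "coeff \<alpha>"] by (simp add: ht_def)
  have s0: "(\<Sum>\<epsilon>\<in>\<Delta>-{\<delta>}. coeff \<alpha> \<epsilon>) \<ge> 0" by (rule sum_nonneg) (auto intro: nn)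
  then have "coeff \<alpha> \<delta> = 1" "(\<Sum>\<epsilon>\<in>\<Delta>-{\<delta>}. coeff \<alpha> \<epsilon>) = 0" using ge split by linarith+
  then have "\<forall>\<epsilon>\<in>\<Delta>-{\<delta>}. coeff \<alpha> \<epsilon> = 0"
    using nn by (subst (asm) sum_nonneg_eq_0_iff) (auto simp: finite_simple)
  then have "(\<Sum>\<epsilon>\<in>\<Delta>. coeff \<alpha> \<epsilon> *\<^sub>R \<epsilon>) = \<delta>"
    using sum.remove[OF finite_simple d(1), of "\<lambda>\<epsilon>. coeff \<alpha> \<epsilon> *\<^sub>R \<epsilon>"] \<open>coeff \<alpha> \<delta> = 1\<close> by simp
  then show ?thesis using d(1) coeff_expansion by simp
qed

text \<open>Reflecting \<beta> in \<alpha> keeps the coefficient 1 at \<beta>; the new coefficient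
  \<open>- cartan \<beta> \<alpha>\<close> at \<alpha> can therefore not be negative.\<close>

lemma simple_obtuse:
  assumes "\<alpha> \<in> \<Delta>" "\<beta> \<in> \<Delta>" "\<alpha> \<noteq> \<beta>"
  shows "inner \<alpha> \<beta> \<le> 0"
proof -
  have "\<beta> - cartan \<beta> \<alpha> *\<^sub>R \<alpha> \<in> \<Phi>" using assms by (intro reflection simple_in_roots)
  from no_mixed_signs[OF this assms(2) _ assms(1)] have "cartan \<beta> \<alpha> \<le> 0"
    using assms by (simp add: coeff_diff coeff_scale coeff_simple)
  moreover have "inner \<alpha> \<alpha> > 0" using simple_in_roots[OF assms(1)] zero_not_root by auto
  ultimately show ?thesis by (simp add: cartan_def field_simps inner_commute)
qed

lemma inner_span_orthogonal:
  assumes "\<forall>a\<in>S. \<forall>b\<in>R. inner a b = 0" "u \<in> span S" "v \<in> span R"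
  shows "inner u v = 0"
proof -
  have "inner u b = 0" if "b \<in> R" for b
    using assms(2) by (induction rule: span_induct_alt) (use assms(1) that in \<open>auto simp: inner_add_left\<close>)
  with assms(3) show ?thesis
    by (induction rule: span_induct_alt) (auto simp: inner_add_right)
qed

text \<open>A positive root that is not simple has a positive inner product with some simple root \<open>\<delta>\<close>;
  reflecting in \<open>\<delta>\<close> lowers the height.\<close>

lemma positive_root_in_component:
  assumes S: "S \<subseteq> \<Delta>" and orth: "\<forall>a\<in>S. \<forall>b\<in>\<Delta> - S. inner a b = 0"
    and "\<gamma> \<in> positive_roots \<Phi> \<Delta>" "ht \<Delta> \<gamma> = real m"
  shows "\<gamma> \<in> span S \<or> \<gamma> \<in> span (\<Delta> - S)"
  using assms(3,4)
proof (induction m arbitrary: \<gamma> rule: less_induct)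
  case (less m)
  note g = positive_root[OF less.prems(1)]
  show ?case
  proof (cases "\<gamma> \<in> \<Delta>")
    case True
    then show ?thesis using span_base[of \<gamma> S] span_base[of \<gamma> "\<Delta> - S"] by blast
  next
    case False
    have nn: "coeff \<gamma> \<delta> \<ge> 0" if "\<delta> \<in> \<Delta>" for \<delta> using less.prems(1) that by (simp add: positive_roots_def)
    have "inner \<gamma> \<gamma> > 0" using g zero_not_root by auto
    also have "inner \<gamma> \<gamma> = inner \<gamma> (\<Sum>\<delta>\<in>\<Delta>. coeff \<gamma> \<delta> *\<^sub>R \<delta>)" by (simp only: coeff_expansion)
    also have "\<dots> = (\<Sum>\<delta>\<in>\<Delta>. coeff \<gamma> \<delta> * inner \<gamma> \<delta>)" by (simp add: inner_sum_right)
    finally obtain \<delta> where d: "\<delta> \<in> \<Delta>" "coeff \<gamma> \<delta> * inner \<gamma> \<delta> > 0"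
      by (meson sum_nonpos not_le)
    then have ip: "inner \<gamma> \<delta> > 0" using nn[OF d(1)] by (simp add: zero_less_mult_iff)
    have d0: "inner \<delta> \<delta> > 0" using simple_in_roots[OF d(1)] zero_not_root by auto
    have cpos: "cartan \<gamma> \<delta> > 0" using ip d0 by (simp add: cartan_def)
    define \<eta> where "\<eta> = \<gamma> - cartan \<gamma> \<delta> *\<^sub>R \<delta>"
    have \<eta>: "\<eta> \<in> \<Phi>" unfolding \<eta>_def using g simple_in_roots[OF d(1)] by (rule reflection[rotated])
    \<comment> \<open>A second simple root in the support is untouched by the reflection in \<delta>
      and keeps \<eta> positive. Without it \<gamma> would be a multiple of \<delta>, hence \<delta>
      itself.\<close>
    have "\<exists>\<epsilon>\<in>\<Delta>. \<epsilon> \<noteq> \<delta> \<and> coeff \<gamma> \<epsilon> > 0"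
    proof (rule ccontr)
      assume "\<not> ?thesis"
      then have "\<forall>\<epsilon>\<in>\<Delta>-{\<delta>}. coeff \<gamma> \<epsilon> = 0" using nn by force
      then have "\<gamma> = coeff \<gamma> \<delta> *\<^sub>R \<delta>"
        using coeff_expansion[of \<gamma>] sum.remove[OF finite_simple d(1), of "\<lambda>\<epsilon>. coeff \<gamma> \<epsilon> *\<^sub>R \<epsilon>"] by simp
      moreover from this have "coeff \<gamma> \<delta> = 1"
        using reduced[OF simple_in_roots[OF d(1)], of "coeff \<gamma> \<delta>"] g nn[OF d(1)] by auto
      ultimately show False using False d(1) by simp
    qed
    then obtain \<epsilon> where e: "\<epsilon> \<in> \<Delta>" "\<epsilon> \<noteq> \<delta>" "coeff \<gamma> \<epsilon> > 0" by blast
    then have \<eta>pos: "\<eta> \<in> positive_roots \<Phi> \<Delta>"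
      by (intro positiveI[OF \<eta> e(1)]) (simp add: \<eta>_def coeff_diff coeff_scale coeff_simple[OF d(1)])
    then obtain k where k: "ht \<Delta> \<eta> = real k" using positive_ht_nat by blast
    have "ht \<Delta> \<eta> < ht \<Delta> \<gamma>" using cpos by (simp add: \<eta>_def ht_linear ht_simple[OF d(1)])
    then have "k < m" using k less.prems(2) by simp
    note IH = less.IH[OF this \<eta>pos k]
    have geq: "\<gamma> = \<eta> + cartan \<gamma> \<delta> *\<^sub>R \<delta>" by (simp add: \<eta>_def)
    \<comment> \<open>The reflection negates the inner product with \<delta>, so it stays nonzero.
      Hence \<delta> belongs to the component of \<eta>, and \<gamma> does too.\<close>
    have nonorth: "inner \<eta> \<delta> \<noteq> 0"
    proof
      assume "inner \<eta> \<delta> = 0"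
      then have "cartan \<gamma> \<delta> = cartan \<gamma> \<delta> * 2"
        using cartan_linear(2)[of \<gamma> "cartan \<gamma> \<delta> *\<^sub>R \<delta>" \<delta>] cartan_self[of \<delta>] d0
        by (simp add: \<eta>_def[symmetric] cartan_linear cartan_def[of \<eta>] inner_commute)
      then show False using cpos by simp
    qed
    from IH show ?thesis
    proof
      assume h: "\<eta> \<in> span S"
      have "\<delta> \<in> S"
      proof (rule ccontr)
        assume "\<delta> \<notin> S"
        then have "inner \<eta> \<delta> = 0" using d(1) by (intro inner_span_orthogonal[OF orth h] span_base) auto
        then show False using nonorth by simp
      qed
      then have "\<gamma> \<in> span S" by (subst geq) (intro span_add span_scale span_base h)
      then show ?thesis ..
    next
      assume h: "\<eta> \<in> span (\<Delta> - S)"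
      have "\<delta> \<notin> S"
      proof
        assume "\<delta> \<in> S"
        then have "inner \<delta> \<eta> = 0" by (intro inner_span_orthogonal[OF orth _ h] span_base)
        then show False using nonorth by (simp add: inner_commute)
      qed
      then have "\<gamma> \<in> span (\<Delta> - S)" using d(1) by (subst geq) (intro span_add span_scale span_base h, auto)
      then show ?thesis ..
    qed
  qed
qed

text \<open>An orthogonal splitting of the simple roots would split all roots, positive ones by
  \<open>positive_root_in_component\<close> and the others by negation, against
  irreducibility.\<close>

lemma simple_roots_connected:
  assumes S: "S \<subseteq> \<Delta>" "S \<noteq> {}" and orth: "\<forall>a\<in>S. \<forall>b\<in>\<Delta> - S. inner a b = 0"
  shows "S = \<Delta>"
proof (rule ccontr)
  assume "S \<noteq> \<Delta>"
  let ?A = "\<Phi> \<inter> span S" and ?B = "\<Phi> \<inter> span (\<Delta> - S)"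
  have "?A \<noteq> {}" "?B \<noteq> {}" using S \<open>S \<noteq> \<Delta>\<close> simple_in_roots by (auto intro: span_base)
  moreover have "?A \<inter> ?B = {}"
  proof -
    have "v = 0" if "v \<in> span S" "v \<in> span (\<Delta> - S)" for v
      using inner_span_orthogonal[OF orth that] by simp
    then show ?thesis using zero_not_root by blast
  qed
  moreover have "?A \<union> ?B = \<Phi>"
  proof -
    have "\<alpha> \<in> span S \<or> \<alpha> \<in> span (\<Delta> - S)" if "\<alpha> \<in> \<Phi>" for \<alpha>
    proof -
      have *: "\<beta> \<in> span S \<or> \<beta> \<in> span (\<Delta> - S)" if "\<beta> \<in> positive_roots \<Phi> \<Delta>" for \<beta>
        using positive_ht_nat[OF that] positive_root_in_component[OF S(1) orth that] by blast
      from root_pos_or_neg[OF that] show ?thesis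
        using *[of \<alpha>] *[of "- \<alpha>"] span_neg[of "- \<alpha>"] by auto
    qed
    then show ?thesis by blast
  qed
  moreover have "\<forall>\<alpha>\<in>?A. \<forall>\<beta>\<in>?B. inner \<alpha> \<beta> = 0" using inner_span_orthogonal[OF orth] by blast
  ultimately have "\<exists>A B. A \<noteq> {} \<and> B \<noteq> {} \<and> A \<inter> B = {} \<and> A \<union> B = \<Phi> \<and> (\<forall>\<alpha>\<in>A. \<forall>\<beta>\<in>B. inner \<alpha> \<beta> = 0)"
    by (intro exI[of _ ?A] exI[of _ ?B] conjI)
  then show False using irreducible unfolding irreducible_root_system_def by (elim conjE notE)
qed

section \<open>The highest root and the exceptional small ranks\<close>

definition highest_root :: "'v \<Rightarrow> bool" where
  "highest_root \<theta> \<longleftrightarrow> \<theta> \<in> positive_roots \<Phi> \<Delta> \<and> (\<forall>\<alpha>\<in>positive_roots \<Phi> \<Delta>. ht \<Delta> \<alpha> \<le> ht \<Delta> \<theta>)"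

text \<open>A simple root with negative inner product would reflect \<theta> to a positive root of
  greater height.\<close>

lemma highest_root_dominant:
  assumes "highest_root \<theta>" "\<delta> \<in> \<Delta>"
  shows "inner \<theta> \<delta> \<ge> 0"
proof (rule ccontr)
  assume "\<not> ?thesis"
  moreover have "inner \<delta> \<delta> > 0" using simple_in_roots[OF assms(2)] zero_not_root by auto
  ultimately have c: "cartan \<theta> \<delta> < 0" by (simp add: cartan_def divide_neg_pos)
  have \<theta>: "\<theta> \<in> positive_roots \<Phi> \<Delta>" using assms(1) by (simp add: highest_root_def)
  let ?r = "\<theta> - cartan \<theta> \<delta> *\<^sub>R \<delta>"
  have "?r \<in> \<Phi>" using reflection[OF simple_in_roots[OF assms(2)] positive_root[OF \<theta>]] .
  moreover have "coeff ?r \<delta> > 0"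
    using c \<theta> assms(2) by (simp add: coeff_diff coeff_scale coeff_simple positive_roots_def add_nonneg_pos less_le_trans[of _ 0])
  ultimately have "?r \<in> positive_roots \<Phi> \<Delta>" using positiveI assms(2) by blast
  then have "ht \<Delta> ?r \<le> ht \<Delta> \<theta>" using assms(1) by (simp add: highest_root_def)
  then show False using c by (simp add: ht_linear ht_simple[OF assms(2)])
qed

text \<open>For a simple root b outside the support S of \<theta>, the inner product with \<theta>
  is nonnegative by dominance, while each of its terms is nonpositive by obtuseness. So all terms
  vanish, S is orthogonal to its complement, and connectedness gives S = \<Delta>.\<close>

lemma highest_root_full_support:
  assumes "highest_root \<theta>" "\<delta> \<in> \<Delta>"
  shows "coeff \<theta> \<delta> \<noteq> 0"
proof -
  have \<theta>: "\<theta> \<in> positive_roots \<Phi> \<Delta>" using assms(1) by (simp add: highest_root_def)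
  have nn: "coeff \<theta> \<delta> \<ge> 0" if "\<delta> \<in> \<Delta>" for \<delta> using \<theta> that by (simp add: positive_roots_def)
  define S where "S = {\<delta>\<in>\<Delta>. coeff \<theta> \<delta> \<noteq> 0}"
  have "inner a b = 0" if ab: "a \<in> S" "b \<in> \<Delta> - S" for a b
  proof -
    have "inner \<theta> b = inner (\<Sum>\<delta>\<in>\<Delta>. coeff \<theta> \<delta> *\<^sub>R \<delta>) b" by (simp only: coeff_expansion)
    also have "\<dots> = (\<Sum>\<delta>\<in>\<Delta>. coeff \<theta> \<delta> * inner \<delta> b)" by (simp add: inner_sum_left)
    finally have sum: "0 \<le> (\<Sum>\<delta>\<in>\<Delta>. coeff \<theta> \<delta> * inner \<delta> b)"
      using highest_root_dominant[OF assms(1), of b] ab by simp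
    have np: "coeff \<theta> \<delta> * inner \<delta> b \<le> 0" if "\<delta> \<in> \<Delta>" for \<delta>
    proof (cases "\<delta> = b")
      case True then show ?thesis using ab(2) by (simp add: S_def)
    next
      case False then show ?thesis using simple_obtuse[of \<delta> b] that ab(2) nn[OF that]
        by (simp add: mult_nonneg_nonpos)
    qed
    have "(\<Sum>\<delta>\<in>\<Delta>. - (coeff \<theta> \<delta> * inner \<delta> b)) = 0"
      using sum sum_nonpos[of \<Delta> "\<lambda>\<delta>. coeff \<theta> \<delta> * inner \<delta> b"] np by (simp add: sum_negf)
    then have "coeff \<theta> a * inner a b = 0"
      using ab(1) np by (subst (asm) sum_nonneg_eq_0_iff) (auto simp: finite_simple S_def)
    then show ?thesis using ab(1) by (simp add: S_def)
  qed
  moreover have "S \<noteq> {}"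
  proof
    assume "S = {}"
    then have "\<theta> = 0" using coeff_expansion[of \<theta>] by (simp add: S_def)
    then show False using positive_root[OF \<theta>] zero_not_root by simp
  qed
  ultimately have "S = \<Delta>" by (intro simple_roots_connected) (auto simp: S_def)
  then show ?thesis using assms(2) by (auto simp: S_def)
qed

lemma highest_root_simple:
  assumes "highest_root \<theta>" "\<theta> \<in> \<Delta>"
  shows "\<Delta> = {\<theta>}"
proof -
  have "\<delta> = \<theta>" if "\<delta> \<in> \<Delta>" for \<delta>
    using highest_root_full_support[OF assms(1) that] coeff_simple[OF assms(2)] by (auto split: if_splits)
  then show ?thesis using assms(2) by blast
qed

text \<open>A consequence of full support. The scalar \<open>a\<close> is 1 when \<theta> - \<alpha>
  is simple, and 2 when \<theta> - 2\<alpha> is simple.\<close>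

lemma highest_root_rank_two:
  assumes "highest_root (\<beta> + a *\<^sub>R \<alpha>)" "\<alpha> \<in> \<Delta>" "\<beta> \<in> \<Delta>"
  shows "\<Delta> = {\<alpha>, \<beta>}"
proof -
  have "\<delta> = \<alpha> \<or> \<delta> = \<beta>" if "\<delta> \<in> \<Delta>" for \<delta>
    using highest_root_full_support[OF assms(1) that]
    by (auto simp: coeff_add coeff_scale coeff_simple assms split: if_splits)
  then show ?thesis using assms by blast
qed

text \<open>The reflection of \<beta> in \<alpha> has height at most 2, which bounds the integer
  below by -1; obtuseness bounds it above by 0. The value 0 would make \<beta> - \<alpha>, the
  reflection of \<alpha> + \<beta>, a root with mixed signs.\<close>

lemma cartan_of_height_two_highest:
  assumes h: "highest_root (\<alpha> + \<beta>)" and ab: "\<alpha> \<in> \<Delta>" "\<beta> \<in> \<Delta>" "\<alpha> \<noteq> \<beta>"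
  shows "cartan \<beta> \<alpha> = -1"
proof -
  note r = ab(1,2)[THEN simple_in_roots]
  have a0: "inner \<alpha> \<alpha> > 0" using r(1) zero_not_root by auto
  have "\<beta> - cartan \<beta> \<alpha> *\<^sub>R \<alpha> \<in> positive_roots \<Phi> \<Delta>"
    using ab by (intro positiveI[OF reflection[OF r] ab(2)]) (simp add: coeff_diff coeff_scale coeff_simple)
  then have "ht \<Delta> (\<beta> - cartan \<beta> \<alpha> *\<^sub>R \<alpha>) \<le> ht \<Delta> (\<alpha> + \<beta>)" using h by (simp add: highest_root_def)
  then have lo: "cartan \<beta> \<alpha> \<ge> -1" by (simp add: ht_linear ht_simple ab)
  have hi: "cartan \<beta> \<alpha> \<le> 0" using simple_obtuse[OF ab] a0
    by (simp add: cartan_def inner_commute divide_nonpos_pos)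
  have ne: "cartan \<beta> \<alpha> \<noteq> 0"
  proof
    assume z: "cartan \<beta> \<alpha> = 0"
    have "(\<alpha> + \<beta>) - cartan (\<alpha> + \<beta>) \<alpha> *\<^sub>R \<alpha> \<in> \<Phi>"
      using h r(1) positive_root by (intro reflection) (auto simp: highest_root_def)
    moreover have "cartan (\<alpha> + \<beta>) \<alpha> = 2" using z a0 cartan_self[of \<alpha>] by (auto simp: cartan_linear)
    ultimately have "\<beta> - \<alpha> \<in> \<Phi>" by (simp add: scaleR_2 algebra_simps)
    from no_mixed_signs[OF this ab(2) _ ab(1)] show False using ab by (auto simp: coeff_diff coeff_simple)
  qed
  obtain z where "cartan \<beta> \<alpha> = of_int z" using cartan_int[OF r] by (auto simp: Ints_def)
  then show ?thesis using lo hi ne by simp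
qed

text \<open>Full support leaves \<alpha> and \<theta> - \<alpha> as the only simple roots. They
  differ because twice a root is not a root, and both Cartan integers between them are -1.\<close>

lemma type_A2_if_height_two:
  assumes h: "highest_root \<theta>" and a: "\<alpha> \<in> \<Delta>"
    and g: "\<theta> - \<alpha> \<in> positive_roots \<Phi> \<Delta>" "ht \<Delta> (\<theta> - \<alpha>) = 1"
  shows "type_A 2 \<Delta>"
proof -
  let ?\<beta> = "\<theta> - \<alpha>"
  have b: "?\<beta> \<in> \<Delta>" using g by (rule ht_one_simple)
  have ne: "\<alpha> \<noteq> ?\<beta>"
  proof
    assume "\<alpha> = ?\<beta>"
    then have "2 *\<^sub>R \<alpha> = \<theta>" by (simp add: scaleR_2 algebra_simps)
    then show False using reduced[OF simple_in_roots[OF a], of 2] h positive_root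
      by (auto simp: highest_root_def)
  qed
  have D: "\<Delta> = {\<alpha>, ?\<beta>}" using h a b by (intro highest_root_rank_two[where a = 1]) simp_all
  have "cartan ?\<beta> \<alpha> = -1" "cartan \<alpha> ?\<beta> = -1"
    using h a b ne by (intro cartan_of_height_two_highest; simp)+
  moreover have "cartan \<alpha> \<alpha> = 2" "cartan ?\<beta> ?\<beta> = 2"
    using simple_in_roots a b zero_not_root by (auto intro!: cartan_self)
  ultimately show ?thesis
    unfolding type_A_def using ne D by (intro exI[of _ "[\<alpha>, ?\<beta>]"]) (auto simp: less_2_cases_iff)
qed

lemma rank_two_if_height_three:
  assumes h: "highest_root \<theta>" and a: "\<alpha> \<in> \<Delta>"
    and g: "\<theta> - 2 *\<^sub>R \<alpha> \<in> positive_roots \<Phi> \<Delta>" "ht \<Delta> (\<theta> - 2 *\<^sub>R \<alpha>) = 1"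
  shows "card \<Delta> \<le> 2"
proof -
  have "\<Delta> = {\<alpha>, \<theta> - 2 *\<^sub>R \<alpha>}"
    using h a ht_one_simple[OF g] by (intro highest_root_rank_two[where a = 2]) simp_all
  then have "card \<Delta> = card {\<alpha>, \<theta> - 2 *\<^sub>R \<alpha>}" by simp
  then show ?thesis by (simp add: card_insert_if)
qed

end

section \<open>Matrices over a field\<close>

text \<open>Surjectivity is what transitivity of the twisted action provides. Conversely to
  inversion, preimages of the unit vectors are the columns of a right inverse, and the determinant
  is multiplicative.\<close>

lemma det_nonzero_iff_surj:
  fixes M :: "'k::field mat"
  assumes M: "M \<in> carrier_mat m m"
  shows "det M \<noteq> 0 \<longleftrightarrow> (\<forall>b\<in>carrier_vec m. \<exists>a\<in>carrier_vec m. M *\<^sub>v a = b)"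
proof
  assume "det M \<noteq> 0"
  from det_non_zero_imp_unit[OF M this, of "()"]
  obtain B where B: "B \<in> carrier_mat m m" "M * B = 1\<^sub>m m"
    by (auto simp: Units_def ring_mat_def)
  have "M *\<^sub>v (B *\<^sub>v b) = b" if "b \<in> carrier_vec m" for b
    using assoc_mult_mat_vec[OF M B(1) that] B(2) that by simp
  then show "\<forall>b\<in>carrier_vec m. \<exists>a\<in>carrier_vec m. M *\<^sub>v a = b"
    using B(1) by (metis mult_mat_vec_carrier)
next
  assume surj: "\<forall>b\<in>carrier_vec m. \<exists>a\<in>carrier_vec m. M *\<^sub>v a = b"
  have "\<forall>j. \<exists>a\<in>carrier_vec m. M *\<^sub>v a = unit_vec m j" using surj by simp
  then obtain a where a: "\<And>j. a j \<in> carrier_vec m" "\<And>j. M *\<^sub>v a j = unit_vec m j" by metis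
  define B where "B = mat_of_cols m (map a [0..<m])"
  have B: "B \<in> carrier_mat m m" using mat_of_cols_carrier(1)[of m "map a [0..<m]"] by (simp add: B_def)
  have cols: "col B j = a j" if "j < m" for j
    using that a by (simp add: B_def)
  have "M * B = 1\<^sub>m m"
  proof (rule eq_matI)
    fix i j assume "i < dim_row (1\<^sub>m m :: 'k mat)" "j < dim_col (1\<^sub>m m :: 'k mat)"
    then have ij: "i < m" "j < m" by auto
    have "(M * B) $$ (i, j) = (M *\<^sub>v a j) $ i" using ij M B cols by simp
    then show "(M * B) $$ (i, j) = 1\<^sub>m m $$ (i, j)" using ij by (simp add: a(2))
  qed (use M B in auto)
  then have "det M * det B = 1" using det_mult[OF M B] by simp
  then show "det M \<noteq> 0" by auto
qed

lemma invertible_mat_iff_det: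
  fixes M :: "'k::field mat"
  assumes M: "M \<in> carrier_mat m m"
  shows "invertible_mat M \<longleftrightarrow> det M \<noteq> 0"
proof
  assume "invertible_mat M"
  then obtain B where "M * B = 1\<^sub>m m" "B * M = 1\<^sub>m (dim_row B)"
    using M by (auto simp: invertible_mat_def inverts_mat_def)
  moreover from this have "B \<in> carrier_mat m m" using M
    by (metis carrier_matD(2) carrier_matI index_mult_mat(2,3) index_one_mat(2,3))
  ultimately have "det M * det B = 1" using det_mult[OF M, of B] by simp
  then show "det M \<noteq> 0" by auto
next
  assume "det M \<noteq> 0"
  from det_non_zero_imp_unit[OF M this, of "()"]
  obtain B where "B \<in> carrier_mat m m" "M * B = 1\<^sub>m m" "B * M = 1\<^sub>m m"
    by (auto simp: Units_def ring_mat_def)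
  then show "invertible_mat M" using M by (auto simp: invertible_mat_def inverts_mat_def square_mat.simps)
qed

lemma det_diag_block_mat:
  fixes As :: "'k::field mat list"
  assumes "\<And>A. A \<in> set As \<Longrightarrow> square_mat A"
  shows "det (diag_block_mat As) = (\<Prod>A\<leftarrow>As. det A)"
  using assms
proof (induction As)
  case (Cons A As)
  have A: "A \<in> carrier_mat (dim_row A) (dim_row A)"
    using Cons.prems[of A] by (auto simp: square_mat.simps)
  have B: "diag_block_mat As \<in> carrier_mat (dim_row (diag_block_mat As)) (dim_row (diag_block_mat As))"
    using diag_block_mat_square[of As] Cons.prems by (auto simp: square_mat.simps)
  have dims: "dim_col A = dim_row A" "dim_col (diag_block_mat As) = dim_row (diag_block_mat As)"
    by (rule carrier_matD(2)[OF A], rule carrier_matD(2)[OF B])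
  have "det (diag_block_mat (A # As)) = det A * det (diag_block_mat As)"
    by (simp only: diag_block_mat.simps Let_def dims det_four_block_mat_lower_left_zero[OF A zero_carrier_mat refl B])
  then show ?case using Cons by simp
qed simp

section \<open>Twisted conjugacy classes and quotient groups\<close>

text \<open>Normality allows the correction to stand on the right, where the commutator formula and
  all leading-term statements put it.\<close>

lemma (in normal) r_coset_eq_iff:
  assumes "a \<in> carrier G" "b \<in> carrier G"
  shows "H #> a = H #> b \<longleftrightarrow> (\<exists>w\<in>H. a = b \<otimes> w)"
proof
  assume "H #> a = H #> b"
  then have "a \<in> b <# H" using rcos_self[OF assms(1) subgroup_axioms] coset_eq assms(2) by auto
  then show "\<exists>w\<in>H. a = b \<otimes> w" by (auto simp: l_coset_def)
next
  assume "\<exists>w\<in>H. a = b \<otimes> w"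
  then have "a \<in> H #> b" using coset_eq assms(2) by (auto simp: l_coset_def)
  then show "H #> a = H #> b" using repr_independence[OF _ assms(2) subgroup_axioms] by simp
qed

lemma (in group_hom) commutant_subgroup:
  assumes "c \<in> carrier H"
  shows "subgroup {a \<in> carrier G. h a \<otimes>\<^bsub>H\<^esub> c = c \<otimes>\<^bsub>H\<^esub> h a} G"
proof (rule G.subgroupI)
  fix a assume "a \<in> {a \<in> carrier G. h a \<otimes>\<^bsub>H\<^esub> c = c \<otimes>\<^bsub>H\<^esub> h a}"
  then have a: "a \<in> carrier G" "h a \<otimes>\<^bsub>H\<^esub> c = c \<otimes>\<^bsub>H\<^esub> h a" by auto
  have "inv\<^bsub>H\<^esub> h a \<otimes>\<^bsub>H\<^esub> c = inv\<^bsub>H\<^esub> h a \<otimes>\<^bsub>H\<^esub> (c \<otimes>\<^bsub>H\<^esub> h a) \<otimes>\<^bsub>H\<^esub> inv\<^bsub>H\<^esub> h a"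
    using a(1) assms by (simp add: H.m_assoc)
  also have "\<dots> = c \<otimes>\<^bsub>H\<^esub> inv\<^bsub>H\<^esub> h a"
    using a assms by (simp add: a(2)[symmetric] H.m_assoc[symmetric])
  finally show "inv a \<in> {a \<in> carrier G. h a \<otimes>\<^bsub>H\<^esub> c = c \<otimes>\<^bsub>H\<^esub> h a}" using a by simp
next
  fix a b assume "a \<in> {a \<in> carrier G. h a \<otimes>\<^bsub>H\<^esub> c = c \<otimes>\<^bsub>H\<^esub> h a}" "b \<in> {a \<in> carrier G. h a \<otimes>\<^bsub>H\<^esub> c = c \<otimes>\<^bsub>H\<^esub> h a}"
  then show "a \<otimes> b \<in> {a \<in> carrier G. h a \<otimes>\<^bsub>H\<^esub> c = c \<otimes>\<^bsub>H\<^esub> h a}"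
    using assms by (auto simp: H.m_assoc) (simp add: H.m_assoc[symmetric])
qed (use assms in \<open>auto intro: exI[of _ "\<one>"]\<close>)

text \<open>Centralizers are subgroups, so commutation passes from generators to products, in one
  argument after the other. The intended \<open>h\<close> is the projection modulo a step of the
  filtration: there the generators commute, although in the group they do not.\<close>

lemma (in group_hom) generate_commute:
  assumes S: "S \<subseteq> carrier G" and T: "T \<subseteq> carrier G"
    and comm: "\<And>s t. s \<in> S \<Longrightarrow> t \<in> T \<Longrightarrow> h s \<otimes>\<^bsub>H\<^esub> h t = h t \<otimes>\<^bsub>H\<^esub> h s"
    and a: "a \<in> generate G S" and b: "b \<in> generate G T"
  shows "h a \<otimes>\<^bsub>H\<^esub> h b = h b \<otimes>\<^bsub>H\<^esub> h a"
proof -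
  have ac: "a \<in> carrier G" using G.generate_in_carrier[OF S a] .
  have "h a \<otimes>\<^bsub>H\<^esub> h t = h t \<otimes>\<^bsub>H\<^esub> h a" if "t \<in> T" for t
  proof -
    have "S \<subseteq> {a \<in> carrier G. h a \<otimes>\<^bsub>H\<^esub> h t = h t \<otimes>\<^bsub>H\<^esub> h a}" using S comm that by blast
    moreover have "h t \<in> carrier H" using T that by auto
    ultimately show ?thesis using G.generate_subgroup_incl[OF _ commutant_subgroup[of "h t"]] a by blast
  qed
  then have "T \<subseteq> {b \<in> carrier G. h b \<otimes>\<^bsub>H\<^esub> h a = h a \<otimes>\<^bsub>H\<^esub> h b}" using T by auto
  from subsetD[OF G.generate_subgroup_incl[OF this commutant_subgroup] b] ac show ?thesis by simp
qed

text \<open>The base point \<open>a\<close> is left free: it is the identity when the matrices are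
  studied, and the image of y when an inner automorphism is absorbed.\<close>

lemma (in group) twisted_orbits_singleton_iff:
  assumes f: "f \<in> hom G G" and a: "a \<in> carrier G"
  shows "card (orbits G (carrier G) (\<lambda>g z. g \<otimes> z \<otimes> f (inv g))) = 1
    \<longleftrightarrow> (\<forall>z\<in>carrier G. \<exists>g\<in>carrier G. z = g \<otimes> a \<otimes> f (inv g))"
proof -
  interpret f: group_hom G G f using f by unfold_locales
  let ?O = "orbit G (\<lambda>g z. g \<otimes> z \<otimes> f (inv g))"
  let ?Os = "orbits G (carrier G) (\<lambda>g z. g \<otimes> z \<otimes> f (inv g))"
  show ?thesis
  proof
    assume "card ?Os = 1"
    then obtain X where X: "?Os = {X}" by (rule card_1_singletonE)
    have self: "z \<in> ?O z" if "z \<in> carrier G" for z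
      using that by (auto simp: orbit_def intro!: exI[of _ "\<one>"])
    have "?O z = X" if "z \<in> carrier G" for z using X that by (auto simp: orbits_def)
    then have "z \<in> ?O a" if "z \<in> carrier G" for z using self that a by blast
    then show "\<forall>z\<in>carrier G. \<exists>g\<in>carrier G. z = g \<otimes> a \<otimes> f (inv g)" unfolding orbit_def by blast
  next
    assume trans: "\<forall>z\<in>carrier G. \<exists>g\<in>carrier G. z = g \<otimes> a \<otimes> f (inv g)"
    have "?O z = carrier G" if z: "z \<in> carrier G" for z
    proof
      show "?O z \<subseteq> carrier G" using z by (auto simp: orbit_def)
      show "carrier G \<subseteq> ?O z"
      proof
        fix v assume "v \<in> carrier G"
        obtain g where g: "g \<in> carrier G" "v = g \<otimes> a \<otimes> f (inv g)" using trans \<open>v \<in> carrier G\<close> by blast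
        obtain k where k: "k \<in> carrier G" "z = k \<otimes> a \<otimes> f (inv k)" using trans z by blast
        have cancel: "inv c \<otimes> (c \<otimes> b) = b" if "c \<in> carrier G" "b \<in> carrier G" for b c
          using that by (simp add: m_assoc[symmetric])
        have "v = (g \<otimes> inv k) \<otimes> z \<otimes> f (inv (g \<otimes> inv k))"
          using g(1) k(1) a unfolding g(2) k(2) by (simp add: m_assoc inv_mult_group cancel)
        then show "v \<in> ?O z" unfolding orbit_def using g(1) k(1) by blast
      qed
    qed
    then have "?Os = {carrier G}" using a by (auto simp: orbits_def)
    then show "card ?Os = 1" by simp
  qed
qed

text \<open>Sortedness makes the split an equality of lists, so ordered products factor along it
  without any reordering.\<close>

lemma filter_le_split:
  fixes f :: "'i \<Rightarrow> nat"
  assumes "sorted (map f xs)"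
  shows "filter (\<lambda>i. h \<le> f i) xs = filter (\<lambda>i. f i = h) xs @ filter (\<lambda>i. Suc h \<le> f i) xs"
  using assms
proof (induction xs)
  case (Cons a xs)
  have "filter (\<lambda>i. f i = h) xs = []" if "Suc h \<le> f a"
    using Cons.prems that by (auto simp: filter_empty_conv)
  then show ?case using Cons by auto
qed simp

lemma filter_less_split:
  fixes f :: "'i \<Rightarrow> nat"
  assumes "sorted (map f xs)"
  shows "xs = filter (\<lambda>i. f i < h) xs @ filter (\<lambda>i. h \<le> f i) xs"
  using assms
proof (induction xs)
  case (Cons a xs)
  have "filter (\<lambda>i. f i < h) xs = []" if "h \<le> f a"
    using Cons.prems that by (force simp: filter_empty_conv)
  then show ?case using Cons by (cases "h \<le> f a") auto
qed simp

section \<open>Groups with coordinates along a central filtration\<close>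

abbreviation list_product :: "('a, 'b) monoid_scheme \<Rightarrow> 'a list \<Rightarrow> 'a" where
  "list_product G as \<equiv> foldr (\<lambda>a b. a \<otimes>\<^bsub>G\<^esub> b) as \<one>\<^bsub>G\<^esub>"

text \<open>Introduced outside the locale because the commutator assumption of the locale already
  refers to it.\<close>

definition height_subgroup ::
  "('a, 'b) monoid_scheme \<Rightarrow> 'i list \<Rightarrow> ('i \<Rightarrow> nat) \<Rightarrow> ('i \<Rightarrow> 'k \<Rightarrow> 'a) \<Rightarrow> nat \<Rightarrow> 'a set" where
  "height_subgroup G rs hgt x h = generate G {x i t | i t. i \<in> set rs \<and> h \<le> hgt i}"

text \<open>The assumption \<open>commutator\<close> keeps from Chevalley's formula that the error
  lies above the height of \<open>i\<close>. As \<open>j\<close> is arbitrary, this is exactly what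
  makes a layer central in the whole quotient.\<close>

locale unipotent_coordinates = group G for G (structure) +
  fixes rs :: "'i list" and hgt :: "'i \<Rightarrow> nat" and x :: "'i \<Rightarrow> 'k::field \<Rightarrow> 'a"
  assumes distinct_rs: "distinct rs" and sorted_rs: "sorted (map hgt rs)"
    and x_closed: "i \<in> set rs \<Longrightarrow> x i t \<in> carrier G"
    and x_add: "i \<in> set rs \<Longrightarrow> x i (t + u) = x i t \<otimes> x i u"
    and commutator: "i \<in> set rs \<Longrightarrow> j \<in> set rs \<Longrightarrow>
      \<exists>w \<in> height_subgroup G rs hgt x (Suc (hgt i)). x i t \<otimes> x j u = x j u \<otimes> x i t \<otimes> w"
    and coordinates:
      "bij_betw (\<lambda>t. list_product G (map (\<lambda>i. x i (t i)) rs)) (set rs \<rightarrow>\<^sub>E UNIV) (carrier G)"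
begin

abbreviation V :: "nat \<Rightarrow> 'a set" where "V \<equiv> height_subgroup G rs hgt x"

abbreviation coord_prod :: "'i list \<Rightarrow> ('i \<Rightarrow> 'k) \<Rightarrow> 'a" where
  "coord_prod is t \<equiv> list_product G (map (\<lambda>i. x i (t i)) is)"

lemma list_product_closed: "set as \<subseteq> carrier G \<Longrightarrow> list_product G as \<in> carrier G"
  by (induction as) auto

lemma list_product_append:
  "set as \<subseteq> carrier G \<Longrightarrow> set bs \<subseteq> carrier G \<Longrightarrow>
    list_product G (as @ bs) = list_product G as \<otimes> list_product G bs"
  by (induction as) (auto simp: m_assoc list_product_closed)

lemma list_product_subgroup: "subgroup K G \<Longrightarrow> set as \<subseteq> K \<Longrightarrow> list_product G as \<in> K"
  by (induction as) (auto simp: subgroup.one_closed subgroup.m_closed)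

lemma x_zero: "i \<in> set rs \<Longrightarrow> x i 0 = \<one>"
  using x_add[of i 0 0] x_closed[of i 0] by (metis add_0 l_cancel_one)

lemma x_minus: "i \<in> set rs \<Longrightarrow> x i (- t) = inv (x i t)"
  using x_add[of i "- t" t] x_zero[of i] x_closed[of i]
  by (intro inv_equality[symmetric]) simp_all

lemma generators_closed: "{x i t | i t. i \<in> set rs \<and> h \<le> hgt i} \<subseteq> carrier G"
  using x_closed by auto

lemma V_subgroup: "subgroup (V h) G"
  unfolding height_subgroup_def by (rule generate_is_subgroup[OF generators_closed])

lemma one_in_V: "\<one> \<in> V h"
  by (rule subgroup.one_closed[OF V_subgroup])

lemma V_closed: "v \<in> V h \<Longrightarrow> v \<in> carrier G"
  using V_subgroup subgroup.subset by blast

lemma V_mono: "h \<le> h' \<Longrightarrow> V h' \<subseteq> V h"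
  unfolding height_subgroup_def by (rule mono_generate) auto

lemma x_in_V: "i \<in> set rs \<Longrightarrow> h \<le> hgt i \<Longrightarrow> x i t \<in> V h"
  unfolding height_subgroup_def by (rule generate.incl) auto

text \<open>Inverses of generators are again root elements, with parameter -t, so no case for
  inverses arises.\<close>

lemma V_induct [consumes 1, case_names one root mult]:
  assumes "v \<in> V h" and "P \<one>"
    and "\<And>i t. i \<in> set rs \<Longrightarrow> h \<le> hgt i \<Longrightarrow> P (x i t)"
    and "\<And>u v. u \<in> V h \<Longrightarrow> v \<in> V h \<Longrightarrow> P u \<Longrightarrow> P v \<Longrightarrow> P (u \<otimes> v)"
  shows "P v"
  using assms(1) unfolding height_subgroup_def
proof (induction rule: generate.induct)
  case (incl v)
  then show ?case using assms(3) by blast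
next
  case (inv v)
  then obtain i t where "v = x i t" "i \<in> set rs" "h \<le> hgt i" by blast
  then show ?case using assms(3)[of i "- t"] by (simp add: x_minus)
next
  case (eng u v)
  then show ?case using assms(4) by (simp add: height_subgroup_def)
qed (rule assms(2))

lemma coord_prod_closed: "set is \<subseteq> set rs \<Longrightarrow> coord_prod is t \<in> carrier G"
  by (rule list_product_closed) (auto intro: x_closed)

lemma coord_prod_in_V: "set is \<subseteq> set rs \<Longrightarrow> (\<And>i. i \<in> set is \<Longrightarrow> h \<le> hgt i) \<Longrightarrow> coord_prod is t \<in> V h"
  by (rule list_product_subgroup[OF V_subgroup]) (auto intro: x_in_V)

lemma coord_prod_append:
  "set is \<subseteq> set rs \<Longrightarrow> set js \<subseteq> set rs \<Longrightarrow> coord_prod (is @ js) t = coord_prod is t \<otimes> coord_prod js t"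
  unfolding map_append by (rule list_product_append) (auto intro: x_closed)

lemma coord_prod_cong: "(\<And>i. i \<in> set is \<Longrightarrow> s i = t i) \<Longrightarrow> coord_prod is s = coord_prod is t"
  by (simp cong: map_cong)

lemma coord_prod_zero: "set is \<subseteq> set rs \<Longrightarrow> (\<And>i. i \<in> set is \<Longrightarrow> t i = 0) \<Longrightarrow> coord_prod is t = \<one>"
  by (induction "is") (auto simp: x_zero)

lemma coord_prod_single:
  assumes "distinct is" "i \<in> set is" "set is \<subseteq> set rs"
    "\<And>j. j \<in> set is \<Longrightarrow> j \<noteq> i \<Longrightarrow> t j = 0"
  shows "coord_prod is t = x i (t i)"
  using assms
proof (induction "is")
  case (Cons j "is")
  show ?case
  proof (cases "j = i")
    case True
    then have "coord_prod is t = \<one>" using Cons.prems by (intro coord_prod_zero) auto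
    then show ?thesis using True Cons.prems x_closed by simp
  next
    case False
    moreover have "x i (t i) \<in> carrier G" using Cons.prems by (intro x_closed) auto
    ultimately show ?thesis using Cons by (simp add: x_zero)
  qed
qed simp

lemma carrier_eq_V0: "carrier G = V 0"
proof
  show "carrier G \<subseteq> V 0"
  proof
    fix g assume "g \<in> carrier G"
    then obtain t where "g = coord_prod rs t" using coordinates by (auto simp: bij_betw_def)
    then show "g \<in> V 0" using coord_prod_in_V[of rs 0 t] by simp
  qed
qed (use V_closed in blast)

lemma coord_prod_inject:
  assumes "coord_prod rs s = coord_prod rs t" "i \<in> set rs"
  shows "s i = t i"
proof -
  have "coord_prod rs (restrict s (set rs)) = coord_prod rs (restrict t (set rs))"
    using assms(1) by (simp cong: map_cong)
  then have "restrict s (set rs) = restrict t (set rs)"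
    using coordinates by (auto simp: bij_betw_def inj_on_def)
  then show ?thesis using assms(2) by (metis restrict_apply')
qed

lemma V_trivial: "(\<And>i. i \<in> set rs \<Longrightarrow> hgt i < h) \<Longrightarrow> V h = {\<one>}"
proof -
  assume "\<And>i. i \<in> set rs \<Longrightarrow> hgt i < h"
  then have "{x i t | i t. i \<in> set rs \<and> h \<le> hgt i} = {}" by force
  then show ?thesis unfolding height_subgroup_def by (simp only: generate_empty)
qed

text \<open>Modulo \<open>V (Suc h)\<close> the generators of \<open>V h\<close> commute with those
  of \<open>V 0\<close>, which is the whole group. Normality is a premise because the downward
  induction that establishes it uses this lemma.\<close>

lemma V_commute:
  assumes N: "V (Suc h) \<lhd> G" and v: "v \<in> V h" and g: "g \<in> carrier G"
  shows "\<exists>w\<in>V (Suc h). v \<otimes> g = g \<otimes> v \<otimes> w"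
proof -
  interpret N: normal "V (Suc h)" G by (rule N)
  interpret \<pi>: group_hom G "G Mod V (Suc h)" "\<lambda>a. V (Suc h) #> a"
    using N.factorgroup_is_group N.r_coset_hom_Mod
    by (simp add: group_hom_def group_hom_axioms_def is_group)
  have "(V (Suc h) #> v) \<otimes>\<^bsub>G Mod V (Suc h)\<^esub> (V (Suc h) #> g)
      = (V (Suc h) #> g) \<otimes>\<^bsub>G Mod V (Suc h)\<^esub> (V (Suc h) #> v)"
  proof (rule \<pi>.generate_commute)
    show "v \<in> generate G {x i t | i t. i \<in> set rs \<and> h \<le> hgt i}"
      using v by (simp add: height_subgroup_def)
    show "g \<in> generate G {x i t | i t. i \<in> set rs \<and> 0 \<le> hgt i}"
      using g unfolding carrier_eq_V0 by (simp add: height_subgroup_def)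
    fix a b assume "a \<in> {x i t | i t. i \<in> set rs \<and> h \<le> hgt i}" "b \<in> {x i t | i t. i \<in> set rs \<and> 0 \<le> hgt i}"
    then obtain i t j u where ij: "a = x i t" "b = x j u" "i \<in> set rs" "j \<in> set rs" "h \<le> hgt i" by blast
    obtain w where "w \<in> V (Suc (hgt i))" "a \<otimes> b = b \<otimes> a \<otimes> w"
      using commutator[OF ij(3,4)] ij(1,2) by blast
    moreover from this(1) have "w \<in> V (Suc h)" using V_mono[of "Suc h" "Suc (hgt i)"] ij by auto
    ultimately have "V (Suc h) #> (a \<otimes> b) = V (Suc h) #> (b \<otimes> a)"
      using ij x_closed by (subst N.r_coset_eq_iff) auto
    then show "(V (Suc h) #> a) \<otimes>\<^bsub>G Mod V (Suc h)\<^esub> (V (Suc h) #> b)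
      = (V (Suc h) #> b) \<otimes>\<^bsub>G Mod V (Suc h)\<^esub> (V (Suc h) #> a)"
      using \<pi>.hom_mult[of a b] \<pi>.hom_mult[of b a] ij x_closed by metis
  qed (use x_closed in auto)
  then have "V (Suc h) #> (v \<otimes> g) = V (Suc h) #> (g \<otimes> v)"
    using V_closed[OF v] g by simp
  then show ?thesis using V_closed[OF v] g by (subst (asm) N.r_coset_eq_iff) auto
qed

lemma height_downward_induct:
  assumes "\<And>h. (\<And>i. i \<in> set rs \<Longrightarrow> hgt i < h) \<Longrightarrow> P h" "\<And>h. P (Suc h) \<Longrightarrow> P h"
  shows "P h"
proof -
  \<comment> \<open>Above the largest height the first assumption applies; inserting 0 keeps
    \<open>Max\<close> meaningful for an empty list of roots.\<close>
  define m where "m = Suc (Max (insert 0 (hgt ` set rs)))"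
  have top: "P k" if "m \<le> k" for k
    using that by (intro assms(1)) (auto simp: m_def less_eq_Suc_le intro: order_trans[rotated] Max_ge)
  show ?thesis
  proof (cases "m \<le> h")
    case False
    then have "h \<le> m" by simp
    then show ?thesis by (induction rule: inc_induct) (auto intro: top assms(2))
  qed (rule top)
qed

text \<open>Downward induction: if \<open>V (h + 1)\<close> is normal, then \<open>V h\<close> is central modulo \<open>V (h + 1)\<close>, hence
  normal as well.\<close>

lemma V_normal: "V h \<lhd> G"
proof (induction h rule: height_downward_induct)
  case (1 h)
  then show ?case using V_trivial[of h] one_is_normal by simp
next
  case (2 h)
  show ?case
  proof (rule normal_invI[OF V_subgroup])
    fix g v assume gv: "g \<in> carrier G" "v \<in> V h"
    have vc: "v \<in> carrier G" using V_closed gv by blast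
    obtain w where w: "w \<in> V (Suc h)" "v \<otimes> inv g = inv g \<otimes> v \<otimes> w"
      using V_commute[OF 2 gv(2) inv_closed[OF gv(1)]] by blast
    have wc: "w \<in> carrier G" using V_closed w by blast
    have "g \<otimes> v \<otimes> inv g = g \<otimes> (inv g \<otimes> v \<otimes> w)"
      using w(2) gv(1) vc by (simp add: m_assoc)
    also have "\<dots> = v \<otimes> w" using gv(1) vc wc by (simp add: m_assoc[symmetric])
    also have "\<dots> \<in> V h" using gv(2) w(1) V_mono[of h "Suc h"] V_subgroup by (auto intro: subgroup.m_closed)
    finally show "g \<otimes> v \<otimes> inv g \<in> V h" .
  qed
qed

section \<open>Layers of the filtration as coordinate spaces\<close>

abbreviation cl :: "nat \<Rightarrow> 'a \<Rightarrow> 'a set" where "cl h a \<equiv> V (Suc h) #> a"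

abbreviation Q :: "nat \<Rightarrow> 'a set monoid" where "Q h \<equiv> G Mod V (Suc h)"

lemma cl_hom: "group_hom G (Q h) (cl h)"
  using normal.factorgroup_is_group[OF V_normal] normal.r_coset_hom_Mod[OF V_normal]
  by (simp add: group_hom_def group_hom_axioms_def is_group)

lemma cl_eq_iff:
  "a \<in> carrier G \<Longrightarrow> b \<in> carrier G \<Longrightarrow> cl h a = cl h b \<longleftrightarrow> (\<exists>w\<in>V (Suc h). a = b \<otimes> w)"
  by (rule normal.r_coset_eq_iff[OF V_normal])

lemma cl_mult:
  "a \<in> carrier G \<Longrightarrow> b \<in> carrier G \<Longrightarrow> cl h (a \<otimes> b) = cl h a \<otimes>\<^bsub>Q h\<^esub> cl h b"
  using group_hom.hom_mult[OF cl_hom] by blast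

lemma cl_mult_cong:
  "a \<in> carrier G \<Longrightarrow> b \<in> carrier G \<Longrightarrow> a' \<in> carrier G \<Longrightarrow> b' \<in> carrier G \<Longrightarrow>
    cl h a = cl h a' \<Longrightarrow> cl h b = cl h b' \<Longrightarrow> cl h (a \<otimes> b) = cl h (a' \<otimes> b')"
  by (simp add: cl_mult)

lemma cl_commute: "v \<in> V h \<Longrightarrow> g \<in> carrier G \<Longrightarrow> cl h (v \<otimes> g) = cl h (g \<otimes> v)"
  using V_commute[OF V_normal] V_closed by (subst cl_eq_iff) auto

lemma cl_one_iff: "a \<in> carrier G \<Longrightarrow> cl h a = cl h \<one> \<longleftrightarrow> a \<in> V (Suc h)"
  using V_closed by (subst cl_eq_iff) auto

text \<open>Factors of height h are central modulo \<open>V (Suc h)\<close>, so those of the second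
  product can be moved next to their partners in the first.\<close>

lemma cl_coord_prod_add:
  assumes "set is \<subseteq> {i \<in> set rs. hgt i = h}"
  shows "cl h (coord_prod is s \<otimes> coord_prod is t) = cl h (coord_prod is (\<lambda>i. s i + t i))"
  using assms
proof (induction "is")
  case (Cons i "is")
  have c: "coord_prod is s \<in> carrier G" "coord_prod is t \<in> carrier G" "x i (s i) \<in> carrier G" "x i (t i) \<in> carrier G"
    "coord_prod is (\<lambda>i. s i + t i) \<in> carrier G"
    using Cons.prems by (auto intro!: coord_prod_closed x_closed)
  have "x i (t i) \<in> V h" using Cons.prems by (intro x_in_V) auto
  then have comm: "cl h (coord_prod is s \<otimes> x i (t i)) = cl h (x i (t i) \<otimes> coord_prod is s)"
    using c(1) by (rule cl_commute[symmetric])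
  have "cl h (coord_prod (i # is) s \<otimes> coord_prod (i # is) t) = cl h (x i (s i) \<otimes> ((coord_prod is s \<otimes> x i (t i)) \<otimes> coord_prod is t))"
    using c by (simp add: m_assoc)
  also have "\<dots> = cl h (x i (s i) \<otimes> ((x i (t i) \<otimes> coord_prod is s) \<otimes> coord_prod is t))"
    by (rule cl_mult_cong[OF _ _ _ _ refl cl_mult_cong[OF _ _ _ _ comm refl]]) (use c in simp_all)
  also have "\<dots> = cl h ((x i (s i) \<otimes> x i (t i)) \<otimes> (coord_prod is s \<otimes> coord_prod is t))"
    using c by (simp add: m_assoc)
  also have "\<dots> = cl h ((x i (s i) \<otimes> x i (t i)) \<otimes> coord_prod is (\<lambda>i. s i + t i))"
    by (rule cl_mult_cong[OF _ _ _ _ refl Cons.IH]) (use c Cons.prems in simp_all)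
  finally show ?case using Cons.prems c by (simp add: x_add)
qed simp

abbreviation L :: "nat \<Rightarrow> 'i list" where "L h \<equiv> filter (\<lambda>i. hgt i = h) rs"

abbreviation F :: "nat \<Rightarrow> 'i list" where "F h \<equiv> filter (\<lambda>i. h \<le> hgt i) rs"

lemma cl_coordinates:
  assumes "v \<in> V h"
  shows "\<exists>t. cl h v = cl h (coord_prod (L h) t)"
  using assms
proof (induction rule: V_induct)
  case one
  then show ?case using coord_prod_zero[of "L h" "\<lambda>_. 0"] by (intro exI[of _ "\<lambda>_. 0"]) simp
next
  case (root i t)
  show ?case
  proof (cases "hgt i = h")
    case True
    then have "coord_prod (L h) (\<lambda>j. if j = i then t else 0) = x i t"
      using root distinct_rs by (subst coord_prod_single[of _ i]) auto
    then show ?thesis by metis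
  next
    case False
    then have "x i t \<in> V (Suc h)" using root by (intro x_in_V) auto
    then have "cl h (x i t) = cl h \<one>" using root x_closed by (simp add: cl_one_iff)
    then show ?thesis using coord_prod_zero[of "L h" "\<lambda>_. 0"] by (intro exI[of _ "\<lambda>_. 0"]) simp
  qed
next
  case (mult u v)
  then obtain s t where st: "cl h u = cl h (coord_prod (L h) s)" "cl h v = cl h (coord_prod (L h) t)" by blast
  have "cl h (u \<otimes> v) = cl h (coord_prod (L h) s \<otimes> coord_prod (L h) t)"
    using st mult V_closed by (intro cl_mult_cong) (auto intro!: coord_prod_closed)
  then show ?case using cl_coord_prod_add[of "L h"] by auto
qed

text \<open>Removing the layer of height h leaves a remainder in \<open>V (Suc h)\<close>, whose
  coordinates come from the induction. The two tuples live on disjoint parts of \<open>rs\<close>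
  and can be glued.\<close>

lemma V_coordinates:
  assumes "v \<in> V h"
  shows "\<exists>t. v = coord_prod (F h) t"
  using assms
proof (induction h arbitrary: v rule: height_downward_induct)
  case (1 h)
  then have "F h = []" by (force simp: filter_empty_conv)
  then show ?case using V_trivial[of h] 1 by simp
next
  case (2 h)
  obtain t where "cl h v = cl h (coord_prod (L h) t)" using cl_coordinates[OF 2(2)] by blast
  then obtain w where w: "w \<in> V (Suc h)" "v = coord_prod (L h) t \<otimes> w"
    using cl_eq_iff[of v "coord_prod (L h) t"] V_closed[OF 2(2)] coord_prod_closed[of "L h"] by auto
  obtain s where s: "w = coord_prod (F (Suc h)) s" using 2(1)[OF w(1)] by blast
  have "v = coord_prod (L h @ F (Suc h)) (\<lambda>i. if hgt i = h then t i else s i)"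
    unfolding w(2) s by (subst coord_prod_append) (auto intro!: arg_cong2[of _ _ _ _ "\<lambda>a b. a \<otimes> b"] coord_prod_cong)
  then show ?case unfolding filter_le_split[OF sorted_rs, symmetric]
    by (intro exI[of _ "\<lambda>i. if hgt i = h then t i else s i"])
qed

text \<open>The tuple \<open>ext t r\<close>, equal to 0 below h, to \<open>t\<close> at h and to
  \<open>r\<close> above, turns both sides into full ordered products, where coordinates are unique
  by assumption.\<close>

lemma layer_unique:
  assumes "cl h (coord_prod (L h) s) = cl h (coord_prod (L h) t)" "i \<in> set (L h)"
  shows "s i = t i"
proof -
  obtain w where w: "w \<in> V (Suc h)" "coord_prod (L h) s = coord_prod (L h) t \<otimes> w"
    using assms(1) cl_eq_iff[of "coord_prod (L h) s" "coord_prod (L h) t"] coord_prod_closed[of "L h"] by auto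
  obtain r where r: "w = coord_prod (F (Suc h)) r" using V_coordinates[OF w(1)] by blast
  define ext where "ext t r = (\<lambda>i. if hgt i < h then 0 else if hgt i = h then t i else (r i :: 'k))" for t r
  have *: "coord_prod rs (ext t r) = coord_prod (L h) t \<otimes> coord_prod (F (Suc h)) r" for t r
  proof -
    have "coord_prod rs (ext t r) = coord_prod (filter (\<lambda>i. hgt i < h) rs @ (L h @ F (Suc h))) (ext t r)"
      using filter_less_split[OF sorted_rs, of h] filter_le_split[OF sorted_rs, of h] by simp
    also have "\<dots> = coord_prod (filter (\<lambda>i. hgt i < h) rs) (ext t r) \<otimes> (coord_prod (L h) (ext t r) \<otimes> coord_prod (F (Suc h)) (ext t r))"
      using coord_prod_append[of "filter (\<lambda>i. hgt i < h) rs" "L h @ F (Suc h)" "ext t r"]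
        coord_prod_append[of "L h" "F (Suc h)" "ext t r"] by (simp del: foldr_append map_append)
    also have "coord_prod (filter (\<lambda>i. hgt i < h) rs) (ext t r) = \<one>"
      by (rule coord_prod_zero) (auto simp: ext_def)
    also have "coord_prod (L h) (ext t r) = coord_prod (L h) t" by (rule coord_prod_cong) (auto simp: ext_def)
    also have "coord_prod (F (Suc h)) (ext t r) = coord_prod (F (Suc h)) r" by (rule coord_prod_cong) (auto simp: ext_def)
    finally show ?thesis by (simp add: coord_prod_closed)
  qed
  have "coord_prod (F (Suc h)) (\<lambda>_. 0) = \<one>" by (rule coord_prod_zero) auto
  then have "coord_prod rs (ext s (\<lambda>_. 0)) = coord_prod rs (ext t r)"
    unfolding * using w(2) r coord_prod_closed[of "L h" s] by simp
  from coord_prod_inject[OF this, of i] show ?thesis using assms(2) by (simp add: ext_def)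
qed

text \<open>For v in \<open>V h\<close> a suitable \<open>t\<close> exists by
  \<open>cl_coordinates\<close>, and \<open>layer_unique\<close> shows that the choice does not
  affect its values on \<open>L h\<close>.\<close>

definition layer :: "nat \<Rightarrow> 'a \<Rightarrow> 'k vec" where
  "layer h v = vec (length (L h)) (\<lambda>k. (SOME t. cl h v = cl h (coord_prod (L h) t)) (L h ! k))"

lemma layer_carrier: "layer h v \<in> carrier_vec (length (L h))"
  by (simp add: layer_def)

lemma layer_eq:
  assumes "cl h v = cl h (coord_prod (L h) t)"
  shows "layer h v = vec (length (L h)) (\<lambda>k. t (L h ! k))"
proof -
  have "cl h v = cl h (coord_prod (L h) (SOME t. cl h v = cl h (coord_prod (L h) t)))"
    using assms by (rule someI[of "\<lambda>t. cl h v = cl h (coord_prod (L h) t)" t])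
  then have "cl h (coord_prod (L h) (SOME t. cl h v = cl h (coord_prod (L h) t))) = cl h (coord_prod (L h) t)"
    using assms by simp
  from layer_unique[OF this nth_mem] show ?thesis unfolding layer_def by (intro eq_vecI) simp_all
qed

lemma layer_cong: "cl h u = cl h v \<Longrightarrow> layer h u = layer h v"
  by (simp add: layer_def)

lemma layer_mult:
  assumes "u \<in> V h" "v \<in> V h"
  shows "layer h (u \<otimes> v) = layer h u + layer h v"
proof -
  obtain s t where st: "cl h u = cl h (coord_prod (L h) s)" "cl h v = cl h (coord_prod (L h) t)"
    using cl_coordinates[OF assms(1)] cl_coordinates[OF assms(2)] by blast
  have "cl h (u \<otimes> v) = cl h (coord_prod (L h) s \<otimes> coord_prod (L h) t)"
    using st assms V_closed by (intro cl_mult_cong) (auto intro!: coord_prod_closed)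
  also have "\<dots> = cl h (coord_prod (L h) (\<lambda>i. s i + t i))" by (rule cl_coord_prod_add) auto
  finally show ?thesis unfolding layer_eq[OF st(1)] layer_eq[OF st(2)]
    by (subst layer_eq) (auto intro!: eq_vecI)
qed

lemma layer_zero_iff:
  assumes "v \<in> V h"
  shows "layer h v = 0\<^sub>v (length (L h)) \<longleftrightarrow> v \<in> V (Suc h)"
proof -
  have z: "cl h \<one> = cl h (coord_prod (L h) (\<lambda>_. 0))" using coord_prod_zero[of "L h" "\<lambda>_. 0"] by simp
  obtain t where t: "cl h v = cl h (coord_prod (L h) t)" using cl_coordinates[OF assms] by blast
  show ?thesis
  proof
    assume z0: "layer h v = 0\<^sub>v (length (L h))"
    have "t (L h ! k) = 0" if "k < length (L h)" for k
      using arg_cong[OF z0[unfolded layer_eq[OF t]], of "\<lambda>v. v $ k"] that by simp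
    then have "t i = 0" if "i \<in> set (L h)" for i using that by (metis in_set_conv_nth)
    then have "coord_prod (L h) t = \<one>" by (intro coord_prod_zero) auto
    then show "v \<in> V (Suc h)" using t cl_one_iff V_closed[OF assms] by simp
  next
    assume "v \<in> V (Suc h)"
    then have "cl h v = cl h \<one>" using cl_one_iff[OF V_closed[OF assms]] by blast
    then have "cl h v = cl h (coord_prod (L h) (\<lambda>_. 0))" using z by (rule trans)
    then show "layer h v = 0\<^sub>v (length (L h))" by (subst layer_eq) auto
  qed
qed

lemma layer_surj:
  assumes "a \<in> carrier_vec (length (L h))"
  shows "\<exists>v\<in>V h. layer h v = a"
proof -
  \<comment> \<open>The inverse of indexing into \<open>L h\<close>, well defined because the
    entries are distinct.\<close>
  define t where "t = (\<lambda>i. a $ (THE k. k < length (L h) \<and> L h ! k = i))"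
  have "t (L h ! k) = a $ k" if "k < length (L h)" for k
  proof -
    have "(THE k'. k' < length (L h) \<and> L h ! k' = L h ! k) = k"
      using that distinct_rs by (intro the_equality) (auto simp: nth_eq_iff_index_eq)
    then show ?thesis by (simp add: t_def)
  qed
  then have "layer h (coord_prod (L h) t) = a"
    using assms by (subst layer_eq[OF refl]) (auto intro!: eq_vecI)
  moreover have "coord_prod (L h) t \<in> V h" by (rule coord_prod_in_V) auto
  ultimately show ?thesis by blast
qed

lemma layer_root:
  assumes "i \<in> set rs" "hgt i = h"
  shows "layer h (x i s) = vec (length (L h)) (\<lambda>k. if L h ! k = i then s else 0)"
proof -
  have "coord_prod (L h) (\<lambda>j. if j = i then s else 0) = x i s"
    using assms distinct_rs by (subst coord_prod_single[of _ i]) auto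
  then show ?thesis by (subst layer_eq[of h _ "\<lambda>j. if j = i then s else 0"]) auto
qed

text \<open>Factors to the left of z are conjugated across it and stay in the normal subgroup
  \<open>V (Suc h)\<close>. Since \<open>y\<close> is an arbitrary family, the lemma also covers
  products whose roots have been permuted by a graph automorphism.\<close>

lemma list_product_leading:
  assumes i: "i \<in> set rs" and z: "z \<in> carrier G" "y i = z"
    and y: "\<And>j. j \<in> set rs \<Longrightarrow> j \<noteq> i \<Longrightarrow> y j \<in> V (Suc h)"
  shows "\<exists>w\<in>V (Suc h). list_product G (map y rs) = z \<otimes> w"
proof -
  have "\<exists>w\<in>V (Suc h). list_product G (map y is) = z \<otimes> w"
    if "distinct is" "i \<in> set is" "set is \<subseteq> set rs" for "is"
    using that
  proof (induction "is")
    case (Cons j "is")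
    show ?case
    proof (cases "j = i")
      case True
      have "list_product G (map y is) \<in> V (Suc h)"
        using Cons.prems y True by (intro list_product_subgroup[OF V_subgroup]) auto
      then show ?thesis using True z(2) by auto
    next
      case False
      then have yj: "y j \<in> V (Suc h)" using Cons.prems y by auto
      obtain w where w: "w \<in> V (Suc h)" "list_product G (map y is) = z \<otimes> w"
        using Cons False by auto
      have "inv z \<otimes> y j \<otimes> z \<in> V (Suc h)"
        using normal.inv_op_closed1[OF V_normal z(1) yj] .
      then have "inv z \<otimes> y j \<otimes> z \<otimes> w \<in> V (Suc h)"
        using w V_subgroup by (auto intro: subgroup.m_closed)
      moreover have "y j \<otimes> (z \<otimes> w) = z \<otimes> (inv z \<otimes> y j \<otimes> z \<otimes> w)"
        using V_closed[OF yj] V_closed[OF w(1)] z(1) by (simp add: m_assoc[symmetric])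
      ultimately show ?thesis using w(2) by auto
    qed
  qed simp
  then show ?thesis using distinct_rs i by blast
qed

text \<open>Makes maps defined by coordinate formulas computable on a coset: up to the height of
  \<open>i\<close> only the coordinate at \<open>i\<close> survives.\<close>

lemma coset_coordinates:
  assumes i: "i \<in> set rs" and w: "w \<in> V (Suc (hgt i))"
  shows "\<exists>s. x i t \<otimes> w = coord_prod rs s \<and> s i = t \<and> (\<forall>j\<in>set rs. j \<noteq> i \<longrightarrow> hgt j \<le> hgt i \<longrightarrow> s j = 0)"
proof -
  let ?h = "Suc (hgt i)"
  obtain r where r: "w = coord_prod (F ?h) r" using V_coordinates[OF w] by blast
  define s where "s = (\<lambda>j. if j = i then t else if hgt j \<le> hgt i then 0 else r j)"
  have "coord_prod rs s = coord_prod (filter (\<lambda>i. hgt i < ?h) rs @ F ?h) s"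
    using filter_less_split[OF sorted_rs, of ?h] by simp
  also have "\<dots> = coord_prod (filter (\<lambda>i. hgt i < ?h) rs) s \<otimes> coord_prod (F ?h) s" by (rule coord_prod_append) auto
  also have "coord_prod (filter (\<lambda>i. hgt i < ?h) rs) s = x i (s i)"
    using i distinct_rs by (intro coord_prod_single) (auto simp: s_def)
  also have "coord_prod (F ?h) s = w" unfolding r by (rule coord_prod_cong) (auto simp: s_def)
  finally have "x i t \<otimes> w = coord_prod rs s" by (simp add: s_def)
  then show ?thesis by (intro exI[of _ s]) (auto simp: s_def)
qed

text \<open>Triviality on all layers, tested on root elements. The homomorphism condition extends it
  to arbitrary elements of \<open>V h\<close>.\<close>

definition unitriangular :: "('a \<Rightarrow> 'a) \<Rightarrow> bool" where
  "unitriangular f \<longleftrightarrow> f \<in> hom G G \<and>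
     (\<forall>i\<in>set rs. \<forall>t. \<exists>w\<in>V (Suc (hgt i)). f (x i t) = x i t \<otimes> w)"

text \<open>Composed with the projection modulo \<open>V (Suc h)\<close>, \<open>f\<close> and the
  identity agree on the generators of \<open>V h\<close>, hence on \<open>V h\<close>.\<close>

lemma unitriangular_V:
  assumes f: "unitriangular f" and v: "v \<in> V h"
  shows "\<exists>w\<in>V (Suc h). f v = v \<otimes> w"
proof -
  have hom: "f \<in> hom G G" using f by (simp add: unitriangular_def)
  interpret f: group_hom G G f using hom by unfold_locales
  have "cl h (f v) = cl h v" using v
  proof (induction rule: V_induct)
    case (root i t)
    obtain w where w: "w \<in> V (Suc (hgt i))" "f (x i t) = x i t \<otimes> w"
      using f root by (auto simp: unitriangular_def)
    have "w \<in> V (Suc h)" using w(1) V_mono[of "Suc h" "Suc (hgt i)"] root by auto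
    then show ?case using w(2) root(1) x_closed V_closed[OF w(1)] by (subst cl_eq_iff) auto
  next
    case (mult u v)
    then have "u \<in> carrier G" "v \<in> carrier G" using V_closed by blast+
    then show ?case using cl_mult_cong[OF _ _ _ _ mult(3,4)] by simp
  qed simp
  then show ?thesis using V_closed[OF v] by (subst (asm) cl_eq_iff) auto
qed

lemma unitriangular_in_V: "unitriangular f \<Longrightarrow> v \<in> V h \<Longrightarrow> f v \<in> V h"
  using unitriangular_V[of f v h] V_mono[of h "Suc h"] subgroup.m_closed[OF V_subgroup] by force

lemma unitriangular_coset:
  assumes f: "unitriangular f" and i: "i \<in> set rs" and w: "w \<in> V (Suc (hgt i))"
  shows "\<exists>w'\<in>V (Suc (hgt i)). f (x i t \<otimes> w) = x i t \<otimes> w'"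
proof -
  obtain u where u: "u \<in> V (Suc (hgt i))" "f (x i t) = x i t \<otimes> u"
    using f i by (auto simp: unitriangular_def)
  have "f (x i t \<otimes> w) = f (x i t) \<otimes> f w"
    using f i w x_closed V_closed by (auto simp: unitriangular_def intro: hom_mult)
  also have "\<dots> = x i t \<otimes> (u \<otimes> f w)"
    using u x_closed[OF i] V_closed[OF u(1)] V_closed[OF unitriangular_in_V[OF f w]]
    by (simp add: m_assoc)
  finally show ?thesis
    using subgroup.m_closed[OF V_subgroup u(1) unitriangular_in_V[OF f w]] by blast
qed

lemma unitriangular_compose:
  assumes f: "unitriangular f" and g: "unitriangular g"
  shows "unitriangular (compose (carrier G) f g)"
proof -
  have "compose (carrier G) f g \<in> hom G G"
    using f g by (intro hom_compose[where H = G]) (auto simp: unitriangular_def)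
  moreover have "\<exists>w\<in>V (Suc (hgt i)). compose (carrier G) f g (x i t) = x i t \<otimes> w"
    if i: "i \<in> set rs" for i t
  proof -
    obtain u where "u \<in> V (Suc (hgt i))" "g (x i t) = x i t \<otimes> u"
      using g i by (auto simp: unitriangular_def)
    then show ?thesis using unitriangular_coset[OF f i] x_closed[OF i] by (simp add: compose_eq)
  qed
  ultimately show ?thesis by (simp add: unitriangular_def)
qed

text \<open>A unitriangular \<open>f\<close> preserves the exact height of an element, so \<open>g v\<close> cannot lie lower in the
  filtration than \<open>v\<close>.\<close>

lemma unitriangular_right_inverse:
  assumes f: "unitriangular f" and g: "g \<in> hom G G" and fg: "\<And>v. v \<in> carrier G \<Longrightarrow> f (g v) = v"
  shows "unitriangular g"
proof -
  have "\<exists>w\<in>V (Suc (hgt i)). g (x i t) = x i t \<otimes> w" if i: "i \<in> set rs" for i t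
  proof -
    let ?v = "x i t"
    have v: "?v \<in> carrier G" using x_closed[OF i] .
    then have gv: "g ?v \<in> carrier G" by (rule hom_in_carrier[OF g])
    have *: "\<exists>w\<in>V (Suc j). g ?v = ?v \<otimes> w" if gV: "g ?v \<in> V j" for j
    proof -
      obtain u where u: "u \<in> V (Suc j)" "?v = g ?v \<otimes> u"
        using unitriangular_V[OF f gV] fg[OF v] by auto
      have "g ?v = (g ?v \<otimes> u) \<otimes> inv u" using gv V_closed[OF u(1)] by (simp add: m_assoc)
      then have "g ?v = ?v \<otimes> inv u" by (simp only: u(2)[symmetric])
      then show ?thesis using subgroup.m_inv_closed[OF V_subgroup u(1)] by blast
    qed
    \<comment> \<open>Each application of the comparison \<open>*\<close> raises \<open>g ?v\<close>
      by one height until that of \<open>i\<close> is reached; one further application then gives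
      the claim.\<close>
    have "g ?v \<in> V j" if "j \<le> hgt i" for j
      using that
    proof (induction j)
      case 0
      then show ?case using gv carrier_eq_V0 by simp
    next
      case (Suc j)
      then obtain w where "w \<in> V (Suc j)" "g ?v = ?v \<otimes> w" using * by auto
      moreover have "?v \<in> V (Suc j)" using x_in_V[OF i] Suc.prems by blast
      ultimately show ?case using subgroup.m_closed[OF V_subgroup] by simp
    qed
    then show ?thesis using * by simp
  qed
  then show ?thesis using g by (simp add: unitriangular_def)
qed

text \<open>Membership in \<open>auto G\<close> is carried through the induction because the
  multiplication of \<open>AutoGroup G\<close> is composition only on its carrier. Inverses are
  needed for generators alone.\<close>

lemma unitriangular_generate:
  assumes S: "\<And>f. f \<in> S \<Longrightarrow> f \<in> auto G \<and> unitriangular f"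
    and f: "f \<in> generate (AutoGroup G) S"
  shows "unitriangular f"
proof -
  have unit: "unitriangular (\<lambda>v\<in>carrier G. v)"
    using id_in_auto x_closed one_in_V
    by (auto simp: unitriangular_def auto_def intro!: bexI[of _ "\<one>"])
  interpret A: group "AutoGroup G" by (rule AutoGroup)
  have carrier: "carrier (AutoGroup G) = auto G" by (simp add: AutoGroup_def)
  have mult: "f \<otimes>\<^bsub>AutoGroup G\<^esub> g = compose (carrier G) f g" if "f \<in> auto G" "g \<in> auto G" for f g
    using that by (simp add: AutoGroup_def BijGroup_def auto_def)
  have A_one: "\<one>\<^bsub>AutoGroup G\<^esub> = (\<lambda>v\<in>carrier G. v)" by (simp add: AutoGroup_def BijGroup_def)
  have "f \<in> auto G \<and> unitriangular f" using f
  proof (induction rule: generate.induct)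
    case one
    then show ?case unfolding A_one using unit id_in_auto by blast
  next
    case (incl f)
    then show ?case by (rule S)
  next
    case (inv f)
    let ?g = "inv\<^bsub>AutoGroup G\<^esub> f"
    have f: "f \<in> auto G" "unitriangular f" using S[OF inv] by auto
    then have g: "?g \<in> auto G" using A.inv_closed[of f] carrier by simp
    have "f \<otimes>\<^bsub>AutoGroup G\<^esub> ?g = \<one>\<^bsub>AutoGroup G\<^esub>" using A.r_inv[of f] f carrier by simp
    then have "compose (carrier G) f ?g = (\<lambda>v\<in>carrier G. v)" using mult[OF f(1) g] A_one by simp
    then have "f (?g v) = v" if "v \<in> carrier G" for v
      using that by (metis compose_eq restrict_apply')
    then show ?case using unitriangular_right_inverse[OF f(2)] g by (simp add: auto_def)
  next
    case (eng f g)
    then have "f \<otimes>\<^bsub>AutoGroup G\<^esub> g \<in> auto G" using A.m_closed[of f g] carrier by simp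
    then show ?case using eng mult unitriangular_compose by simp
  qed
  then show ?thesis ..
qed

end

section \<open>Endomorphisms that permute and scale the coordinates of each layer\<close>

locale graded_endomorphism = unipotent_coordinates G rs hgt x
  for G (structure) and rs :: "'i list" and hgt and x :: "'i \<Rightarrow> 'k::field \<Rightarrow> 'a" +
  fixes f :: "'a \<Rightarrow> 'a" and \<rho> :: "'i \<Rightarrow> 'i" and \<chi> :: "'i \<Rightarrow> 'k"
  assumes f_hom: "f \<in> hom G G"
    and \<rho>: "i \<in> set rs \<Longrightarrow> \<rho> i \<in> set rs \<and> hgt (\<rho> i) = hgt i"
    and f_root: "i \<in> set rs \<Longrightarrow> \<exists>w \<in> V (Suc (hgt i)). f (x i t) = x (\<rho> i) (\<chi> i * t) \<otimes> w"
begin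

sublocale f: group_hom G G f
  using f_hom by unfold_locales

lemma f_V: "v \<in> V h \<Longrightarrow> f v \<in> V h"
proof (induction rule: V_induct)
  case one
  then show ?case using one_in_V by simp
next
  case (root i t)
  obtain w where "w \<in> V (Suc (hgt i))" "f (x i t) = x (\<rho> i) (\<chi> i * t) \<otimes> w" using f_root root by blast
  moreover have "V (Suc (hgt i)) \<subseteq> V h" using V_mono root by simp
  moreover have "x (\<rho> i) (\<chi> i * t) \<in> V h" using \<rho>[OF root(1)] root by (intro x_in_V) auto
  ultimately show ?case using V_subgroup by (auto intro: subgroup.m_closed)
next
  case (mult u v)
  then show ?case using V_closed V_subgroup by (auto intro: subgroup.m_closed)
qed

text \<open>The matrix of the map induced by \<open>f\<close> on the layer of height h: column j
  describes the image of the j-th root.\<close>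

definition P :: "nat \<Rightarrow> 'k mat" where
  "P h = mat (length (L h)) (length (L h)) (\<lambda>(k, j). if \<rho> (L h ! j) = L h ! k then \<chi> (L h ! j) else 0)"

lemma P_carrier: "P h \<in> carrier_mat (length (L h)) (length (L h))"
  by (simp add: P_def)

lemma P_zero: "P h *\<^sub>v 0\<^sub>v (length (L h)) = 0\<^sub>v (length (L h))"
  by (rule eq_vecI) (auto simp: P_def scalar_prod_def)

lemma layer_one: "layer h \<one> = 0\<^sub>v (length (L h))"
  using layer_zero_iff[OF one_in_V] one_in_V by blast

text \<open>Both sides are additive in v, which reduces the claim to root elements. Those above
  height h have zero layer, and so have their images.\<close>

lemma layer_f:
  assumes "v \<in> V h"
  shows "layer h (f v) = P h *\<^sub>v layer h v"
  using assms
proof (induction rule: V_induct)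
  case one
  then show ?case by (simp add: layer_one P_zero)
next
  case (root i t)
  obtain w where w: "w \<in> V (Suc (hgt i))" "f (x i t) = x (\<rho> i) (\<chi> i * t) \<otimes> w" using f_root root by blast
  show ?case
  proof (cases "hgt i = h")
    case True
    have "cl h (f (x i t)) = cl h (x (\<rho> i) (\<chi> i * t))"
      using w V_closed[OF w(1)] True \<rho>[OF root(1)] x_closed by (subst cl_eq_iff) auto
    then have "layer h (f (x i t)) = layer h (x (\<rho> i) (\<chi> i * t))" by (rule layer_cong)
    also have "\<dots> = vec (length (L h)) (\<lambda>k. if L h ! k = \<rho> i then \<chi> i * t else 0)"
      using \<rho>[OF root(1)] True by (simp add: layer_root)
    also have "\<dots> = P h *\<^sub>v layer h (x i t)"
    proof (rule eq_vecI)
      fix k assume "k < dim_vec (P h *\<^sub>v layer h (x i t))"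
      then have k: "k < length (L h)" by (simp add: P_def)
      have bij: "bij_betw ((!) (L h)) {0..<length (L h)} (set (L h))"
        using distinct_rs by (intro bij_betw_nth) auto
      have "(P h *\<^sub>v layer h (x i t)) $ k =
        (\<Sum>j\<in>{0..<length (L h)}. (if \<rho> (L h ! j) = L h ! k then \<chi> (L h ! j) else 0) * (if L h ! j = i then t else 0))"
        using k by (simp add: P_def scalar_prod_def layer_root[OF root(1) True])
      also have "\<dots> = (\<Sum>j\<in>set (L h). (if \<rho> j = L h ! k then \<chi> j else 0) * (if j = i then t else 0))"
        by (rule sum.reindex_bij_betw[OF bij])
      also have "\<dots> = (\<Sum>j\<in>set (L h). if j = i then (if \<rho> j = L h ! k then \<chi> j else 0) * t else 0)"
        by (intro sum.cong) auto
      also have "\<dots> = (if \<rho> i = L h ! k then \<chi> i else 0) * t"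
        using root(1) True by (subst sum.delta) auto
      finally show "vec (length (L h)) (\<lambda>k. if L h ! k = \<rho> i then \<chi> i * t else 0) $ k
          = (P h *\<^sub>v layer h (x i t)) $ k" using k by auto
    qed (simp add: P_def)
    finally show ?thesis .
  next
    case False
    then have "x i t \<in> V (Suc h)" "f (x i t) \<in> V (Suc h)" using root by (auto intro!: f_V x_in_V)
    moreover from this have "x i t \<in> V h" "f (x i t) \<in> V h" using V_mono[of h "Suc h"] by auto
    ultimately have "layer h (x i t) = 0\<^sub>v (length (L h))" "layer h (f (x i t)) = 0\<^sub>v (length (L h))"
      using layer_zero_iff by blast+
    then show ?thesis by (simp add: P_zero)
  qed
next
  case (mult u v)
  then show ?case using V_closed P_carrier[of h]
    by (simp add: f_V layer_mult mult_add_distrib_mat_vec[OF _ layer_carrier layer_carrier])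
qed

definition M :: "nat \<Rightarrow> 'k mat" where
  "M h = P h - 1\<^sub>m (length (L h))"

lemma M_carrier: "M h \<in> carrier_mat (length (L h)) (length (L h))"
  unfolding M_def by (rule minus_carrier_mat) simp

text \<open>Inverses are avoided by applying additivity to the equation y f(g) = g z, where y is the
  twisted translate of z by g.\<close>

lemma layer_twisted:
  assumes g: "g \<in> V h" and z: "z \<in> V h"
  shows "g \<otimes> z \<otimes> inv (f g) \<in> V h"
    and "layer h (g \<otimes> z \<otimes> inv (f g)) = layer h z - M h *\<^sub>v layer h g"
proof -
  let ?y = "g \<otimes> z \<otimes> inv (f g)"
  show y: "?y \<in> V h"
    using g z f_V V_subgroup by (auto intro!: subgroup.m_closed subgroup.m_inv_closed)
  have "?y \<otimes> f g = g \<otimes> z" using g z V_closed by (simp add: m_assoc)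
  then have "layer h ?y + layer h (f g) = layer h g + layer h z"
    using layer_mult[OF y f_V[OF g]] layer_mult[OF g z] by simp
  then have eq: "layer h ?y + P h *\<^sub>v layer h g = layer h g + layer h z" by (simp add: layer_f g)
  have m: "M h *\<^sub>v layer h g = P h *\<^sub>v layer h g - layer h g"
    unfolding M_def using layer_carrier[of h g] P_carrier[of h]
    by (subst minus_mult_distrib_mat_vec) auto
  show "layer h ?y = layer h z - M h *\<^sub>v layer h g"
  proof (rule eq_vecI)
    fix k assume "k < dim_vec (layer h z - M h *\<^sub>v layer h g)"
    then have k: "k < length (L h)" using layer_carrier[of h g] by (simp add: m)
    have d: "dim_vec (layer h v) = length (L h)" for v using layer_carrier[of h v] by simp
    have "dim_row (P h) = length (L h)" by (simp add: P_def)
    then show "layer h ?y $ k = (layer h z - M h *\<^sub>v layer h g) $ k"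
      using arg_cong[OF eq, of "\<lambda>v. v $ k"] k d unfolding m
      by (simp add: algebra_simps del: index_mult_mat_vec)
  qed (use layer_carrier[of h ?y] layer_carrier[of h g] m in auto)
qed

lemma V_eventually_trivial: "\<exists>h. V h = {\<one>}"
proof -
  have "hgt i < Suc (Max (insert 0 (hgt ` set rs)))" if "i \<in> set rs" for i
    using that by (simp add: less_Suc_eq_le)
  then show ?thesis using V_trivial by blast
qed

lemma twisted_transitive_iff:
  "(\<forall>z\<in>carrier G. \<exists>g\<in>carrier G. z = g \<otimes> f (inv g)) \<longleftrightarrow> (\<forall>h. det (M h) \<noteq> 0)"
proof
  assume trans: "\<forall>z\<in>carrier G. \<exists>g\<in>carrier G. z = g \<otimes> f (inv g)"
  show "\<forall>h. det (M h) \<noteq> 0"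
  proof
    fix h show "det (M h) \<noteq> 0"
    proof (induction h rule: less_induct)
      case (less h)
      \<comment> \<open>Since the lower matrices are injective, a \<open>g\<close> whose twisted quotient lies in \<open>V h\<close> is itself
        in \<open>V h\<close>, so surjectivity can be tested on the layer of height \<open>h\<close> alone.\<close>
      have in_V: "g \<in> V j" if g: "g \<in> carrier G" "g \<otimes> f (inv g) \<in> V h" and "j \<le> h" for g j
        using \<open>j \<le> h\<close>
      proof (induction j)
        case 0
        then show ?case using g carrier_eq_V0 by simp
      next
        case (Suc j)
        then have gj: "g \<in> V j" by simp
        have "g \<otimes> \<one> \<otimes> inv (f g) \<in> V (Suc j)" using g V_mono[OF Suc.prems] by auto
        then have "layer j (g \<otimes> \<one> \<otimes> inv (f g)) = 0\<^sub>v (length (L j))"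
          using layer_zero_iff[OF layer_twisted(1)[OF gj one_in_V]] by blast
        then have e: "0\<^sub>v (length (L j)) - M j *\<^sub>v layer j g = 0\<^sub>v (length (L j))"
          using layer_twisted(2)[OF gj one_in_V] by (simp add: layer_one)
        have "M j *\<^sub>v layer j g = 0\<^sub>v (length (L j))"
        proof (rule eq_vecI)
          fix k assume "k < dim_vec (0\<^sub>v (length (L j)) :: 'k vec)"
          then show "(M j *\<^sub>v layer j g) $ k = 0\<^sub>v (length (L j)) $ k"
            using arg_cong[OF e, of "\<lambda>v. v $ k"] M_carrier[of j] by (simp del: index_mult_mat_vec)
        qed (use M_carrier[of j] in simp)
        \<comment> \<open>By the induction hypothesis the matrix at the smaller height j has nonzero
          determinant, hence trivial kernel.\<close>
        then have "layer j g = 0\<^sub>v (length (L j))"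
          using less.IH[of j] Suc.prems det_0_iff_vec_prod_zero_field[OF M_carrier[of j]] layer_carrier[of j g]
          by (metis Suc_le_lessD)
        then show ?case using layer_zero_iff[OF gj] by simp
      qed
      have "\<exists>a\<in>carrier_vec (length (L h)). M h *\<^sub>v a = b" if b: "b \<in> carrier_vec (length (L h))" for b
      proof -
        obtain v where v: "v \<in> V h" "layer h v = b" using layer_surj[OF b] by blast
        obtain g where g: "g \<in> carrier G" "v = g \<otimes> f (inv g)" using trans V_closed[OF v(1)] by blast
        then have gV: "g \<in> V h" using in_V[of g h] v by simp
        have e: "b = 0\<^sub>v (length (L h)) - M h *\<^sub>v layer h g"
          using layer_twisted(2)[OF gV one_in_V] v(2) g by (simp add: layer_one)
        \<comment> \<open>The base point is the identity with layer 0, so b is minus the image of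
          \<open>layer h g\<close>; this explains the sign of the preimage.\<close>
        have "M h *\<^sub>v (- layer h g) = b"
          using M_carrier[of h] layer_carrier[of h g] unfolding e
          by (auto simp: mult_mat_vec_def intro!: eq_vecI)
        then show ?thesis using layer_carrier[of h g] by (intro bexI[of _ "- layer h g"]) auto
      qed
      then show ?case using det_nonzero_iff_surj[OF M_carrier] by blast
    qed
  qed
next
  assume inv: "\<forall>h. det (M h) \<noteq> 0"
  have step: "\<exists>g\<in>carrier G. g \<otimes> z \<otimes> inv (f g) \<in> V h" if "z \<in> carrier G" for z h
  proof (induction h)
    case 0
    then show ?case using that carrier_eq_V0 by (intro bexI[of _ \<one>]) auto
  next
    case (Suc h)
    then obtain g where g: "g \<in> carrier G" "g \<otimes> z \<otimes> inv (f g) \<in> V h" by blast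
    let ?y = "g \<otimes> z \<otimes> inv (f g)"
    \<comment> \<open>A further translation by an element with layer \<open>a\<close> subtracts
      \<open>M h\<close> applied to \<open>a\<close>, which cancels the layer of \<open>?y\<close>
      exactly.\<close>
    obtain a where a: "a \<in> carrier_vec (length (L h))" "M h *\<^sub>v a = layer h ?y"
      using inv det_nonzero_iff_surj[OF M_carrier] layer_carrier by metis
    obtain k where k: "k \<in> V h" "layer h k = a" using layer_surj[OF a(1)] by blast
    have "k \<otimes> ?y \<otimes> inv (f k) \<in> V (Suc h)"
      using layer_twisted[OF k(1) g(2)] a k layer_carrier[of h ?y] by (simp flip: layer_zero_iff)
    moreover have "k \<otimes> ?y \<otimes> inv (f k) = (k \<otimes> g) \<otimes> z \<otimes> inv (f (k \<otimes> g))"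
      using V_closed[OF k(1)] g that by (simp add: m_assoc inv_mult_group)
    ultimately show ?case using V_closed[OF k(1)] g by (intro bexI[of _ "k \<otimes> g"]) auto
  qed
  obtain h where h: "V h = {\<one>}" using V_eventually_trivial by blast
  show "\<forall>z\<in>carrier G. \<exists>g\<in>carrier G. z = g \<otimes> f (inv g)"
  proof
    fix z assume z: "z \<in> carrier G"
    obtain g where g: "g \<in> carrier G" "g \<otimes> z \<otimes> inv (f g) = \<one>" using step[OF z, of h] h by auto
    \<comment> \<open>Moving z to the identity by g means z = inv g f(g), so the required witness is
      inv g.\<close>
    then have "inv g \<otimes> f g = inv g \<otimes> (g \<otimes> z \<otimes> inv (f g)) \<otimes> f g" using z by simp
    also have "\<dots> = z" using g(1) z by (simp add: m_assoc) (simp add: m_assoc[symmetric])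
    finally have "z = inv g \<otimes> f (inv (inv g))" using g by simp
    then show "\<exists>g\<in>carrier G. z = g \<otimes> f (inv g)" using g(1) by blast
  qed
qed

end

section \<open>The maximal unipotent subgroup\<close>

locale chevalley_unipotent = based_root_system \<Phi> \<Delta>
  for \<Phi> \<Delta> :: "'v::euclidean_space set" +
  fixes n :: nat and G T U :: "'k::field mat set" and rs :: "'v list"
    and ev :: "'v \<Rightarrow> 'k mat \<Rightarrow> 'k" and x :: "'v \<Rightarrow> 'k \<Rightarrow> 'k mat"
    and c :: "'v \<Rightarrow> 'v \<Rightarrow> nat \<Rightarrow> nat \<Rightarrow> int"
  assumes U_subgroup: "subgroup U (GL n)"
    and chevalley: "chevalley_group n G T \<Phi> ev x c"
    and not_A2: "\<not> type_A 2 \<Delta>"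
    and ordering: "root_ordering \<Phi> \<Delta> rs"
    and positive: "positive_unipotent n x rs U"
begin

text \<open>The real-valued \<open>ht\<close> in the form needed for induction; the two agree on
  positive roots.\<close>

definition hgt :: "'v \<Rightarrow> nat" where "hgt \<alpha> = nat \<lfloor>ht \<Delta> \<alpha>\<rfloor>"

lemma set_rs: "set rs = positive_roots \<Phi> \<Delta>" and distinct_roots: "distinct rs"
  and sorted_roots: "sorted_wrt (\<lambda>\<alpha> \<beta>. ht \<Delta> \<alpha> \<le> ht \<Delta> \<beta>) rs"
  using ordering by (auto simp: root_ordering_def Let_def)

lemma ht_eq_hgt: "\<alpha> \<in> set rs \<Longrightarrow> ht \<Delta> \<alpha> = real (hgt \<alpha>)"
  unfolding set_rs by (erule positive_ht_nat) (simp add: hgt_def)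

lemma hgt_pos: "\<alpha> \<in> set rs \<Longrightarrow> hgt \<alpha> > 0"
  unfolding set_rs by (erule positive_ht_nat) (simp add: hgt_def)

lemma hgt_one_simple: "\<alpha> \<in> set rs \<Longrightarrow> hgt \<alpha> = 1 \<Longrightarrow> \<alpha> \<in> \<Delta>"
  using ht_one_simple[of \<alpha>] ht_eq_hgt[of \<alpha>] by (simp add: set_rs)

lemma simple_in_rs: "\<alpha> \<in> \<Delta> \<Longrightarrow> \<alpha> \<in> set rs"
  by (simp add: set_rs simple_positive)

lemma hgt_simple: "\<alpha> \<in> \<Delta> \<Longrightarrow> hgt \<alpha> = 1"
  by (simp add: hgt_def ht_simple)

text \<open>A type of class \<open>euclidean_space\<close> contains a nonzero vector, so a spanning
  set of simple roots cannot be empty.\<close>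

lemma rs_nonempty: "rs \<noteq> []"
proof
  assume "rs = []"
  then have "\<Delta> = {}" using simple_in_rs by auto
  then have "(UNIV :: 'v set) = {0}" using span_simple by simp
  then show False using nonzero_Basis[OF SOME_Basis] by blast
qed

lemma last_in_rs: "last rs \<in> set rs"
  using rs_nonempty by simp

lemma highest_root_last: "highest_root (last rs)"
proof -
  have "sorted_wrt (\<lambda>\<alpha> \<beta>. ht \<Delta> \<alpha> \<le> ht \<Delta> \<beta>) (butlast rs @ [last rs])"
    using sorted_roots rs_nonempty by simp
  then have "ht \<Delta> \<alpha> \<le> ht \<Delta> (last rs)" if "\<alpha> \<in> set (butlast rs @ [last rs])" for \<alpha>
    using that by (auto simp: sorted_wrt_append)
  then show ?thesis using rs_nonempty last_in_rs by (simp add: highest_root_def set_rs)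
qed

text \<open>The highest root is simple only in rank one, and a simple root different from it
  excludes that case.\<close>

lemma hgt_last:
  assumes "\<alpha> \<in> \<Delta>" "\<alpha> \<noteq> last rs"
  shows "2 \<le> hgt (last rs)"
proof -
  have "hgt (last rs) \<noteq> 1"
    using hgt_one_simple[OF last_in_rs] highest_root_simple[OF highest_root_last] assms by auto
  then show ?thesis using hgt_pos[OF last_in_rs] by linarith
qed

text \<open>This is where type \<open>A\<^sub>2\<close> must be excluded: there \<open>\<phi>\<^sub>u\<close> acts nontrivially on the simple layer.\<close>

lemma hgt_last_minus_simple:
  assumes "\<alpha> \<in> \<Delta>" "last rs - \<alpha> \<in> positive_roots \<Phi> \<Delta>"
  shows "2 \<le> hgt (last rs - \<alpha>)" "2 \<le> hgt (last rs)"
proof -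
  have "hgt (last rs - \<alpha>) \<noteq> 1"
    using type_A2_if_height_two[OF highest_root_last assms] not_A2 assms(2) ht_eq_hgt[of "last rs - \<alpha>"]
    by (auto simp: set_rs)
  then show "2 \<le> hgt (last rs - \<alpha>)" using hgt_pos[of "last rs - \<alpha>"] assms(2) by (simp add: set_rs)
  have "\<alpha> \<noteq> last rs"
    using assms(2) positive_root[of "last rs - \<alpha>"] zero_not_root by auto
  then show "2 \<le> hgt (last rs)" using hgt_last assms(1) by blast
qed

text \<open>If this root were simple, full support would force rank at most 2, against l \<ge>
  3.\<close>

lemma hgt_last_minus_twice_simple:
  assumes "\<alpha> \<in> \<Delta>" "last rs - 2 *\<^sub>R \<alpha> \<in> positive_roots \<Phi> \<Delta>" "type_C l \<Delta>" "l \<ge> 3"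
  shows "2 \<le> hgt (last rs - 2 *\<^sub>R \<alpha>)"
proof -
  have "card \<Delta> = l" using assms(3) distinct_card by (auto simp: type_C_def)
  then have "hgt (last rs - 2 *\<^sub>R \<alpha>) \<noteq> 1"
    using rank_two_if_height_three[OF highest_root_last assms(1,2)] assms(2,4)
      ht_eq_hgt[of "last rs - 2 *\<^sub>R \<alpha>"] by (auto simp: set_rs)
  then show ?thesis using hgt_pos[of "last rs - 2 *\<^sub>R \<alpha>"] assms(2) by (simp add: set_rs)
qed

section \<open>U as a group with root coordinates\<close>

definition H :: "'k mat monoid" where "H = matrix_group n U"

lemma H_simps [simp]: "carrier H = U" "a \<otimes>\<^bsub>H\<^esub> b = a * b" "\<one>\<^bsub>H\<^esub> = 1\<^sub>m n"
  by (simp_all add: H_def GL_def units_of_def ring_mat_def)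

lemma mat_prod_eq: "mat_prod n as = list_product H as"
  unfolding mat_prod_def H_simps ..

lemma group_H: "group H"
  unfolding H_def by (rule group.subgroup_imp_group[OF group_GL U_subgroup])

lemma inv_H: "g \<in> U \<Longrightarrow> inv\<^bsub>GL n\<^esub> g = inv\<^bsub>H\<^esub> g"
  unfolding H_def by (rule group.m_inv_consistent[OF group_GL U_subgroup, symmetric])

lemma root_in_U: "\<alpha> \<in> set rs \<Longrightarrow> x \<alpha> t \<in> U"
  using positive generate.incl[of "x \<alpha> t" "{x \<alpha> t | \<alpha> t. \<alpha> \<in> set rs}" "GL n"]
  by (auto simp: positive_unipotent_def)

lemma chevalley_add: "\<forall>\<alpha>\<in>\<Phi>. \<forall>t u. x \<alpha> (t + u) = x \<alpha> t * x \<alpha> u"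
  using chevalley unfolding chevalley_group_def by (elim conjE)

lemma chevalley_commutator:
  assumes "\<alpha> \<in> \<Phi>" "\<beta> \<in> \<Phi>" "\<beta> \<noteq> - \<alpha>"
  shows "x \<alpha> t * x \<beta> u = x \<beta> u * x \<alpha> t *
    mat_prod n (map (\<lambda>(i, j). x (real i *\<^sub>R \<alpha> + real j *\<^sub>R \<beta>)
      (commutator_coeff c \<alpha> \<beta> i j * t ^ i * u ^ j)) (commutator_pairs \<Phi> \<alpha> \<beta>))"
proof -
  note formulas = chevalley[unfolded chevalley_group_def, THEN conjunct2, THEN conjunct2, THEN conjunct2,
    THEN conjunct2, THEN conjunct2, THEN conjunct2, THEN conjunct2, THEN conjunct2, THEN conjunct2]
  show ?thesis
    by (rule formulas[THEN bspec, OF assms(1), THEN bspec, OF assms(2), THEN mp, OF assms(3),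
      THEN conjunct2, THEN spec, THEN spec])
qed

text \<open>Finiteness of the index set need not be decided: for an infinite set
  \<open>sorted_list_of_set\<close> is empty and the claim is vacuous.\<close>

lemma commutator_pairs_mem:
  "(i, j) \<in> set (commutator_pairs \<Phi> \<alpha> \<beta>) \<Longrightarrow> i > 0 \<and> j > 0 \<and> real i *\<^sub>R \<alpha> + real j *\<^sub>R \<beta> \<in> \<Phi>"
proof -
  let ?A = "prod_encode ` {(i, j). i > 0 \<and> j > 0 \<and> real i *\<^sub>R \<alpha> + real j *\<^sub>R \<beta> \<in> \<Phi>}"
  assume "(i, j) \<in> set (commutator_pairs \<Phi> \<alpha> \<beta>)"
  then obtain m where m: "m \<in> set (sorted_list_of_set ?A)" "prod_decode m = (i, j)"
    by (auto simp: commutator_pairs_def)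
  have "m \<in> ?A"
  proof (cases "finite ?A")
    case True
    then show ?thesis using m(1) by (simp only: set_sorted_list_of_set)
  next
    case False
    then have "sorted_list_of_set ?A = []" by (rule sorted_list_of_set.fold_insort_key.infinite)
    then have "m \<in> set []" using m(1) by argo
    then show ?thesis by simp
  qed
  then show ?thesis using m(2) by auto
qed

lemma root_combination:
  assumes a: "\<alpha> \<in> set rs" and b: "\<beta> \<in> set rs" and ij: "i > 0" "j > 0"
    and r: "real i *\<^sub>R \<alpha> + real j *\<^sub>R \<beta> \<in> \<Phi>"
  shows "real i *\<^sub>R \<alpha> + real j *\<^sub>R \<beta> \<in> set rs"
    and "Suc (hgt \<alpha>) \<le> hgt (real i *\<^sub>R \<alpha> + real j *\<^sub>R \<beta>)"
proof -
  show m: "real i *\<^sub>R \<alpha> + real j *\<^sub>R \<beta> \<in> set rs"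
    using a b r unfolding set_rs by (auto simp: positive_roots_def coeff_add coeff_scale)
  have "real (hgt (real i *\<^sub>R \<alpha> + real j *\<^sub>R \<beta>)) = real (i * hgt \<alpha> + j * hgt \<beta>)"
    using ht_eq_hgt[OF m] ht_eq_hgt[OF a] ht_eq_hgt[OF b] by (simp add: ht_linear)
  then have e: "hgt (real i *\<^sub>R \<alpha> + real j *\<^sub>R \<beta>) = i * hgt \<alpha> + j * hgt \<beta>" by (simp only: of_nat_eq_iff)
  have "1 * hgt \<alpha> \<le> i * hgt \<alpha>" "1 * 1 \<le> j * hgt \<beta>"
    using ij hgt_pos[OF b] by (auto intro!: mult_le_mono simp: Suc_le_eq)
  then show "Suc (hgt \<alpha>) \<le> hgt (real i *\<^sub>R \<alpha> + real j *\<^sub>R \<beta>)" unfolding e by linarith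
qed

text \<open>Positive roots are never opposite, so Chevalley's formula applies. Each factor on its
  right belongs to a root i\<alpha> + j\<beta> with i, j > 0, which is higher than \<alpha>.\<close>

lemma commutator_formula:
  assumes a: "\<alpha> \<in> set rs" and b: "\<beta> \<in> set rs"
  shows "\<exists>w\<in>height_subgroup H rs hgt x (Suc (hgt \<alpha>)). x \<alpha> t * x \<beta> u = x \<beta> u * x \<alpha> t * w"
proof -
  have "\<beta> \<noteq> - \<alpha>"
  proof
    assume "\<beta> = - \<alpha>"
    then have "ht \<Delta> \<beta> = - ht \<Delta> \<alpha>" using ht_linear(3)[of "-1" \<alpha>] by simp
    then show False using ht_eq_hgt[OF a] ht_eq_hgt[OF b] hgt_pos[OF a] by simp
  qed
  let ?w = "mat_prod n (map (\<lambda>(i, j). x (real i *\<^sub>R \<alpha> + real j *\<^sub>R \<beta>)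
    (commutator_coeff c \<alpha> \<beta> i j * t ^ i * u ^ j)) (commutator_pairs \<Phi> \<alpha> \<beta>))"
  have eq: "x \<alpha> t * x \<beta> u = x \<beta> u * x \<alpha> t * ?w"
    using a b positive_root \<open>\<beta> \<noteq> - \<alpha>\<close> unfolding set_rs by (intro chevalley_commutator)
  have sub: "subgroup (height_subgroup H rs hgt x (Suc (hgt \<alpha>))) H"
    unfolding height_subgroup_def by (rule group.generate_is_subgroup[OF group_H]) (auto intro: root_in_U)
  have closed: "list_product H as \<in> height_subgroup H rs hgt x (Suc (hgt \<alpha>))"
    if "set as \<subseteq> height_subgroup H rs hgt x (Suc (hgt \<alpha>))" for as
    using that subgroup.one_closed[OF sub] subgroup.m_closed[OF sub] by (induction as) auto
  have factor: "x (real i *\<^sub>R \<alpha> + real j *\<^sub>R \<beta>) s \<in> height_subgroup H rs hgt x (Suc (hgt \<alpha>))"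
    if "(i, j) \<in> set (commutator_pairs \<Phi> \<alpha> \<beta>)" for i j s
    using commutator_pairs_mem[OF that] root_combination[OF a b, of i j]
    unfolding height_subgroup_def by (intro generate.incl) blast
  have "?w \<in> height_subgroup H rs hgt x (Suc (hgt \<alpha>))"
    unfolding mat_prod_eq by (rule closed) (auto intro: factor)
  with eq show ?thesis by (rule bexI)
qed

sublocale coords: unipotent_coordinates H rs hgt x
proof (intro unipotent_coordinates.intro unipotent_coordinates_axioms.intro group_H)
  show "distinct rs" by (rule distinct_roots)
  show "sorted (map hgt rs)"
    unfolding sorted_map using sorted_roots
    by (rule sorted_wrt_mono_rel[rotated]) (auto simp: hgt_def intro: nat_mono floor_mono)
  show "x i t \<in> carrier H" if "i \<in> set rs" for i t using root_in_U[OF that] by simp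
  show "x i (t + u) = x i t \<otimes>\<^bsub>H\<^esub> x i u" if "i \<in> set rs" for i t u
    using chevalley_add that positive_root unfolding set_rs H_simps by blast
  show "\<exists>w\<in>height_subgroup H rs hgt x (Suc (hgt i)). x i t \<otimes>\<^bsub>H\<^esub> x j u = x j u \<otimes>\<^bsub>H\<^esub> x i t \<otimes>\<^bsub>H\<^esub> w"
    if "i \<in> set rs" "j \<in> set rs" for i j t u
    using commutator_formula[OF that] by simp
  show "bij_betw (\<lambda>t. list_product H (map (\<lambda>i. x i (t i)) rs)) (set rs \<rightarrow>\<^sub>E UNIV) (carrier H)"
    using positive unfolding positive_unipotent_def root_product_def mat_prod_eq H_simps(1) by blast
qed

lemma root_product_eq: "root_product n x rs t = coords.coord_prod rs t"
  by (simp add: root_product_def mat_prod_eq)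

section \<open>Leading terms of extremal, central, graph and diagonal automorphisms\<close>

lemma x_in_V2: "\<alpha> \<in> set rs \<Longrightarrow> 2 \<le> hgt \<alpha> \<Longrightarrow> x \<alpha> t \<in> coords.V 2"
  by (rule coords.x_in_V)

text \<open>Only a simple root element can be moved. Its height is 1, so the correction has to lie
  in \<open>V 2\<close>, and this is what the height bounds on its roots give.\<close>

lemma extremal_unitriangular:
  assumes "f \<in> extremal_phi n \<Phi> \<Delta> x c rs U \<union> extremal_psi n \<Phi> \<Delta> x c rs U"
  shows "f \<in> auto H \<and> coords.unitriangular f"
proof -
  have f: "f \<in> auto H" using assms by (auto simp: extremal_phi_def extremal_psi_def Aut_alg_def H_def)
  obtain \<alpha> where a: "\<alpha> \<in> \<Delta>" "\<And>\<beta> t. \<beta> \<in> set rs \<Longrightarrow> \<beta> \<noteq> \<alpha> \<Longrightarrow> f (x \<beta> t) = x \<beta> t"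
    "\<And>t. \<exists>w\<in>coords.V 2. f (x \<alpha> t) = x \<alpha> t * w"
    using assms
  proof
    assume "f \<in> extremal_phi n \<Phi> \<Delta> x c rs U"
    then obtain \<alpha> u l where a: "\<alpha> \<in> \<Delta>" "last rs - \<alpha> \<in> positive_roots \<Phi> \<Delta>"
      "\<forall>\<beta>\<in>positive_roots \<Phi> \<Delta> - {\<alpha>}. \<forall>t. f (x \<beta> t) = x \<beta> t"
      "\<forall>t. f (x \<alpha> t) = x \<alpha> t * x (last rs - \<alpha>) (u * t) * x (last rs) (l * u * t ^ 2)"
      unfolding extremal_phi_def Let_def by blast
    note hs = hgt_last_minus_simple[OF a(1,2)]
    have "\<exists>w\<in>coords.V 2. f (x \<alpha> t) = x \<alpha> t * w" for t
    proof
      let ?w = "x (last rs - \<alpha>) (u * t) \<otimes>\<^bsub>H\<^esub> x (last rs) (l * u * t ^ 2)"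
      show "?w \<in> coords.V 2"
        using a(2) hs last_in_rs
        by (intro subgroup.m_closed[OF coords.V_subgroup] x_in_V2) (auto simp: set_rs)
      have "f (x \<alpha> t) = x \<alpha> t \<otimes>\<^bsub>H\<^esub> x (last rs - \<alpha>) (u * t) \<otimes>\<^bsub>H\<^esub> x (last rs) (l * u * t ^ 2)"
        using a(4) by simp
      also have "\<dots> = x \<alpha> t \<otimes>\<^bsub>H\<^esub> ?w"
        using a(1,2) last_in_rs simple_in_rs by (intro coords.m_assoc coords.x_closed) (auto simp: set_rs)
      finally show "f (x \<alpha> t) = x \<alpha> t * ?w" by simp
    qed
    then show thesis using a that[of \<alpha>] by (simp add: set_rs)
  next
    assume "f \<in> extremal_psi n \<Phi> \<Delta> x c rs U"
    then obtain \<alpha> u \<mu> \<nu> l where a: "\<alpha> \<in> \<Delta>" "last rs - \<alpha> \<in> positive_roots \<Phi> \<Delta>"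
      "last rs - 2 *\<^sub>R \<alpha> \<in> positive_roots \<Phi> \<Delta>" "type_C l \<Delta>" "l \<ge> 3"
      "\<forall>\<beta>\<in>positive_roots \<Phi> \<Delta> - {\<alpha>}. \<forall>t. f (x \<beta> t) = x \<beta> t"
      "\<forall>t. f (x \<alpha> t) = x \<alpha> t * x (last rs - 2 *\<^sub>R \<alpha>) (u * t) * x (last rs - \<alpha>) (\<mu> * u * t ^ 2)
        * x (last rs) (\<nu> * u * t ^ 3)"
      unfolding extremal_psi_def Let_def by blast
    note hs = hgt_last_minus_simple[OF a(1,2)] hgt_last_minus_twice_simple[OF a(1,3,4,5)]
    have "\<exists>w\<in>coords.V 2. f (x \<alpha> t) = x \<alpha> t * w" for t
    proof
      let ?w = "x (last rs - 2 *\<^sub>R \<alpha>) (u * t) \<otimes>\<^bsub>H\<^esub> (x (last rs - \<alpha>) (\<mu> * u * t ^ 2)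
        \<otimes>\<^bsub>H\<^esub> x (last rs) (\<nu> * u * t ^ 3))"
      show "?w \<in> coords.V 2"
        using a(2,3) hs last_in_rs
        by (intro subgroup.m_closed[OF coords.V_subgroup] x_in_V2) (auto simp: set_rs)
      have "f (x \<alpha> t) = x \<alpha> t \<otimes>\<^bsub>H\<^esub> x (last rs - 2 *\<^sub>R \<alpha>) (u * t)
          \<otimes>\<^bsub>H\<^esub> x (last rs - \<alpha>) (\<mu> * u * t ^ 2) \<otimes>\<^bsub>H\<^esub> x (last rs) (\<nu> * u * t ^ 3)"
        using a(7) by simp
      also have "\<dots> = x \<alpha> t \<otimes>\<^bsub>H\<^esub> ?w"
        using coords.x_closed[OF simple_in_rs[OF a(1)]] coords.x_closed[OF last_in_rs]
          coords.x_closed[of "last rs - \<alpha>"] coords.x_closed[of "last rs - 2 *\<^sub>R \<alpha>"] a(2,3)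
        by (simp add: coords.m_assoc set_rs del: H_simps)
      finally show "f (x \<alpha> t) = x \<alpha> t * ?w" by simp
    qed
    then show thesis using a that[of \<alpha>] by (simp add: set_rs)
  qed
  have "\<exists>w\<in>coords.V (Suc (hgt \<beta>)). f (x \<beta> t) = x \<beta> t \<otimes>\<^bsub>H\<^esub> w" if b: "\<beta> \<in> set rs" for \<beta> t
  proof (cases "\<beta> = \<alpha>")
    case True
    then show ?thesis using a(3) hgt_simple[OF a(1)] by (simp add: numeral_2_eq_2)
  next
    case False
    then show ?thesis using a(2)[OF b] coords.one_in_V coords.r_one[OF coords.x_closed[OF b]]
      by (intro bexI[of _ "\<one>\<^bsub>H\<^esub>"]) auto
  qed
  then show ?thesis using f by (simp add: coords.unitriangular_def auto_def)
qed

lemma extremal_automorphism_unitriangular: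
  "f \<in> extremal_automorphisms n \<Phi> \<Delta> x c rs U \<Longrightarrow> coords.unitriangular f"
  unfolding extremal_automorphisms_def H_def[symmetric] using coords.unitriangular_generate extremal_unitriangular by blast

text \<open>On a root element the formula can change only the last coordinate, and only if
  \<open>i\<close> is simple and not the last root. In that case the last root has height at least
  2.\<close>

lemma central_automorphism_root:
  assumes f: "central_automorphism n x \<Delta> rs U f" and i: "i \<in> set rs"
  shows "\<exists>w\<in>coords.V (Suc (hgt i)). f (x i t) = x i t \<otimes>\<^bsub>H\<^esub> w"
proof -
  let ?N = "last rs"
  obtain g where g: "\<And>\<alpha> a b. \<alpha> \<in> \<Delta> \<Longrightarrow> g \<alpha> (a + b) = g \<alpha> a + (g \<alpha> b :: 'k)"
    and fg: "\<And>t. f (root_product n x rs t) =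
      root_product n x rs (t(?N := t ?N + (\<Sum>\<alpha> \<in> \<Delta> - {?N}. g \<alpha> (t \<alpha>))))"
    using f by (auto simp: central_automorphism_def)
  have g0: "g \<alpha> 0 = 0" if "\<alpha> \<in> \<Delta>" for \<alpha>
    using g[OF that, of 0 0] unfolding add_0_right add_cancel_right_right .
  define s where "s = (\<lambda>j. if j = i then t else 0)"
  define s' where "s' = s(?N := s ?N + (\<Sum>\<alpha> \<in> \<Delta> - {?N}. g \<alpha> (s \<alpha>)))"
  have "x i t = coords.coord_prod rs s"
    using i distinct_roots by (subst coords.coord_prod_single[of _ i]) (auto simp: s_def)
  then have "f (x i t) = coords.coord_prod rs s'" using fg[of s] by (simp add: root_product_eq s'_def)
  moreover have "\<exists>w\<in>coords.V (Suc (hgt i)). coords.coord_prod rs s' = x i t \<otimes>\<^bsub>H\<^esub> w"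
  proof (rule coords.list_product_leading[OF i coords.x_closed[OF i]])
    \<comment> \<open>Relevant when \<open>i\<close> is the last root: the modified coordinate is
      then \<open>i\<close> itself, but the sum omits it.\<close>
    have "(\<Sum>\<alpha> \<in> \<Delta> - {i}. g \<alpha> (s \<alpha>)) = 0" by (rule sum.neutral) (auto simp: s_def g0)
    then show "x i (s' i) = x i t" by (auto simp: s'_def s_def)
    fix j assume j: "j \<in> set rs" "j \<noteq> i"
    show "x j (s' j) \<in> coords.V (Suc (hgt i))"
    proof (cases "j = ?N \<and> i \<in> \<Delta>")
      case True
      then have "Suc (hgt i) \<le> hgt j" using hgt_last[of i] hgt_simple[of i] j by auto
      then show ?thesis by (rule coords.x_in_V[OF j(1)])
    next
      case False
      have "(\<Sum>\<alpha> \<in> \<Delta> - {?N}. g \<alpha> (s \<alpha>)) = 0" if "i \<notin> \<Delta>"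
        using that by (intro sum.neutral) (auto simp: s_def g0)
      then have "s' j = 0" using False j(2) by (auto simp: s'_def s_def)
      then show ?thesis using coords.x_zero[OF j(1)] coords.one_in_V by simp
    qed
  qed
  ultimately show ?thesis by simp
qed

text \<open>A linear map permuting the simple roots preserves heights. The image of a positive root
  thus has positive height and cannot be a negative root.\<close>

lemma symmetry_height:
  assumes \<rho>: "diagram_symmetry \<Phi> \<Delta> \<rho>" and i: "i \<in> set rs"
  shows "\<rho> i \<in> set rs" "hgt (\<rho> i) = hgt i"
proof -
  have lin: "linear \<rho>" using \<rho> by (simp add: diagram_symmetry_def)
  have lin_ht: "linear (ht \<Delta>)" by (rule linearI) (simp_all add: ht_linear)
  have "ht \<Delta> (\<rho> i) = ht \<Delta> (\<rho> (\<Sum>\<delta>\<in>\<Delta>. coeff i \<delta> *\<^sub>R \<delta>))" by (simp only: coeff_expansion)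
  also have "\<dots> = (\<Sum>\<delta>\<in>\<Delta>. coeff i \<delta> * ht \<Delta> (\<rho> \<delta>))"
    by (simp add: linear_sum[OF lin] linear_sum[OF lin_ht] linear_cmul[OF lin] ht_linear)
  also have "\<dots> = (\<Sum>\<delta>\<in>\<Delta>. coeff i \<delta>)"
  proof (rule sum.cong)
    fix \<delta> assume "\<delta> \<in> \<Delta>"
    then have "\<rho> \<delta> \<in> \<Delta>" using \<rho> by (auto simp: diagram_symmetry_def)
    then show "coeff i \<delta> * ht \<Delta> (\<rho> \<delta>) = coeff i \<delta>" by (simp add: ht_simple)
  qed simp
  finally have h: "ht \<Delta> (\<rho> i) = ht \<Delta> i" by (simp add: ht_def)
  then show "hgt (\<rho> i) = hgt i" by (simp add: hgt_def)
  have "\<rho> i \<in> \<Phi>" using \<rho> i positive_root by (auto simp: diagram_symmetry_def set_rs)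
  moreover have "- \<rho> i \<notin> set rs"
  proof
    assume "- \<rho> i \<in> set rs"
    then have "ht \<Delta> (- \<rho> i) > 0" using ht_eq_hgt hgt_pos by simp
    then show False using ht_linear(3)[of "-1" "\<rho> i"] h ht_eq_hgt[OF i] by simp
  qed
  ultimately show "\<rho> i \<in> set rs" using root_pos_or_neg by (auto simp: set_rs)
qed

lemma symmetry_inj: "diagram_symmetry \<Phi> \<Delta> \<rho> \<Longrightarrow> inj_on \<rho> (set rs)"
  using roots_finite positive_root
  by (intro inj_on_subset[OF eq_card_imp_inj_on[of \<Phi> \<rho>]]) (auto simp: diagram_symmetry_def set_rs)

text \<open>Both maps are evaluated by their formulas on the coordinates of the whole coset. Apart
  from \<open>i\<close>, these vanish up to the height of \<open>i\<close>, and \<rho> preserves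
  heights, so a single low factor remains in the permuted product.\<close>

lemma graph_diagonal_root:
  assumes \<rho>: "diagram_symmetry \<Phi> \<Delta> \<rho>" and f: "graph_automorphism n x rs U \<rho> f"
    and d: "diagonal_automorphism n x rs U \<chi> d"
    and i: "i \<in> set rs" and w: "w \<in> coords.V (Suc (hgt i))"
  shows "\<exists>w'\<in>coords.V (Suc (hgt i)). f (d (x i t \<otimes>\<^bsub>H\<^esub> w)) = x (\<rho> i) (\<chi> i * t) \<otimes>\<^bsub>H\<^esub> w'"
proof -
  obtain s where s: "x i t \<otimes>\<^bsub>H\<^esub> w = coords.coord_prod rs s" "s i = t"
    "\<forall>j\<in>set rs. j \<noteq> i \<longrightarrow> hgt j \<le> hgt i \<longrightarrow> s j = 0"
    using coords.coset_coordinates[OF i w] by blast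
  have "d (coords.coord_prod rs s) = root_product n x rs (\<lambda>\<alpha>. \<chi> \<alpha> * s \<alpha>)"
    using d unfolding diagonal_automorphism_def root_product_eq by blast
  moreover have "f (root_product n x rs (\<lambda>\<alpha>. \<chi> \<alpha> * s \<alpha>)) = list_product H (map (\<lambda>\<alpha>. x (\<rho> \<alpha>) (\<chi> \<alpha> * s \<alpha>)) rs)"
    using f unfolding graph_automorphism_def mat_prod_eq by blast
  ultimately have "f (d (x i t \<otimes>\<^bsub>H\<^esub> w)) = list_product H (map (\<lambda>\<alpha>. x (\<rho> \<alpha>) (\<chi> \<alpha> * s \<alpha>)) rs)"
    unfolding s(1) by (simp only:)
  moreover have "\<exists>w'\<in>coords.V (Suc (hgt i)).
    list_product H (map (\<lambda>\<alpha>. x (\<rho> \<alpha>) (\<chi> \<alpha> * s \<alpha>)) rs) = x (\<rho> i) (\<chi> i * t) \<otimes>\<^bsub>H\<^esub> w'"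
  proof (rule coords.list_product_leading[OF i coords.x_closed[OF symmetry_height(1)[OF \<rho> i]]])
    show "x (\<rho> i) (\<chi> i * s i) = x (\<rho> i) (\<chi> i * t)" using s(2) by simp
    fix j assume j: "j \<in> set rs" "j \<noteq> i"
    note \<rho>j = symmetry_height[OF \<rho> j(1)]
    show "x (\<rho> j) (\<chi> j * s j) \<in> coords.V (Suc (hgt i))"
    proof (cases "hgt j \<le> hgt i")
      case True
      then have "s j = 0" using s(3) j by simp
      then show ?thesis using coords.x_zero[OF \<rho>j(1)] coords.one_in_V by simp
    next
      case False
      then show ?thesis using \<rho>j by (intro coords.x_in_V) auto
    qed
  qed
  ultimately show ?thesis by simp
qed

section \<open>Reidemeister numbers of endomorphisms of U\<close>

lemma reidemeister_one_iff:
  assumes f: "f \<in> hom H H" and a: "a \<in> U"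
  shows "reidemeister_number n U f = 1 \<longleftrightarrow> (\<forall>z\<in>U. \<exists>g\<in>U. z = g * a * f (inv\<^bsub>H\<^esub> g))"
proof -
  let ?Os = "orbits H U (\<lambda>g z. g * z * f (inv\<^bsub>GL n\<^esub> g))"
  have "orbit H (\<lambda>g z. g * z * f (inv\<^bsub>GL n\<^esub> g)) z = orbit H (\<lambda>g z. g * z * f (inv\<^bsub>H\<^esub> g)) z" for z
    unfolding orbit_def H_simps by (intro Collect_cong ex_cong1) (auto simp: inv_H)
  then have "?Os = orbits H (carrier H) (\<lambda>g z. g \<otimes>\<^bsub>H\<^esub> z \<otimes>\<^bsub>H\<^esub> f (inv\<^bsub>H\<^esub> g))"
    unfolding orbits_def H_simps by simp
  \<comment> \<open>An infinite set has \<open>card\<close> 0, so cardinality 1 already includes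
    finiteness.\<close>
  moreover have "reidemeister_number n U f = 1 \<longleftrightarrow> card ?Os = 1"
    unfolding reidemeister_number_def Let_def H_def[symmetric]
    by (auto simp: one_enat_def card_eq_0_iff dest: card_ge_0_finite)
  ultimately show ?thesis using coords.twisted_orbits_singleton_iff[OF f, of a] a by simp
qed

lemma inner_aut_hom:
  assumes "y \<in> U"
  shows "inner_aut n U y \<in> hom H H"
proof -
  have e: "inner_aut n U y g = y \<otimes>\<^bsub>H\<^esub> g \<otimes>\<^bsub>H\<^esub> inv\<^bsub>H\<^esub> y" if "g \<in> carrier H" for g
    using that assms by (simp add: inner_aut_def inv_H)
  have y: "y \<in> carrier H" using assms by simp
  have cancel: "inv\<^bsub>H\<^esub> y \<otimes>\<^bsub>H\<^esub> (y \<otimes>\<^bsub>H\<^esub> b) = b" if "b \<in> carrier H" for b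
    using that y by (simp add: coords.m_assoc[symmetric] del: H_simps)
  show ?thesis
    by (rule homI) (use y in \<open>simp_all add: e coords.m_assoc cancel del: H_simps\<close>)
qed

text \<open>Right multiplication by \<open>f y\<close> carries the orbits twisted by \<open>f \<circ> Int\<^sub>y\<close> to those twisted by \<open>f\<close>.\<close>

lemma reidemeister_inner:
  assumes f: "f \<in> hom H H" and y: "y \<in> U"
  shows "reidemeister_number n U (compose U f (inner_aut n U y)) = 1 \<longleftrightarrow> reidemeister_number n U f = 1"
proof -
  interpret f: group_hom H H f using f by unfold_locales
  let ?f = "compose U f (inner_aut n U y)"
  have yH: "y \<in> carrier H" using y by simp
  have hom: "?f \<in> hom H H"
    using coords.hom_compose[OF inner_aut_hom[OF y] f] by simp
  have fy: "f y \<in> carrier H" using yH by (rule f.hom_closed)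
  have eq: "?f g = f y \<otimes>\<^bsub>H\<^esub> f g \<otimes>\<^bsub>H\<^esub> inv\<^bsub>H\<^esub> (f y)" if g: "g \<in> carrier H" for g
  proof -
    have "?f g = f (y \<otimes>\<^bsub>H\<^esub> g \<otimes>\<^bsub>H\<^esub> inv\<^bsub>H\<^esub> y)"
      using g y by (simp add: compose_eq inner_aut_def inv_H)
    then show ?thesis using g yH by (simp del: H_simps)
  qed
  have *: "z = g \<otimes>\<^bsub>H\<^esub> \<one>\<^bsub>H\<^esub> \<otimes>\<^bsub>H\<^esub> ?f (inv\<^bsub>H\<^esub> g) \<longleftrightarrow> z \<otimes>\<^bsub>H\<^esub> f y = g \<otimes>\<^bsub>H\<^esub> f y \<otimes>\<^bsub>H\<^esub> f (inv\<^bsub>H\<^esub> g)"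
    if "g \<in> carrier H" "z \<in> carrier H" for g z
  proof -
    have fg: "f (inv\<^bsub>H\<^esub> g) \<in> carrier H" using that by (intro f.hom_closed) (simp del: H_simps)
    have "g \<otimes>\<^bsub>H\<^esub> \<one>\<^bsub>H\<^esub> \<otimes>\<^bsub>H\<^esub> ?f (inv\<^bsub>H\<^esub> g) = (g \<otimes>\<^bsub>H\<^esub> f y \<otimes>\<^bsub>H\<^esub> f (inv\<^bsub>H\<^esub> g)) \<otimes>\<^bsub>H\<^esub> inv\<^bsub>H\<^esub> (f y)"
      using that fy fg by (simp add: eq coords.m_assoc del: H_simps f.hom_inv)
    moreover have "z = (g \<otimes>\<^bsub>H\<^esub> f y \<otimes>\<^bsub>H\<^esub> f (inv\<^bsub>H\<^esub> g)) \<otimes>\<^bsub>H\<^esub> inv\<^bsub>H\<^esub> (f y)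
        \<longleftrightarrow> g \<otimes>\<^bsub>H\<^esub> f y \<otimes>\<^bsub>H\<^esub> f (inv\<^bsub>H\<^esub> g) = z \<otimes>\<^bsub>H\<^esub> f y"
      by (rule coords.inv_solve_right) (intro that fy fg coords.m_closed)+
    ultimately show ?thesis by (simp only: eq_commute)
  qed
  have "(\<forall>z\<in>carrier H. \<exists>g\<in>carrier H. z \<otimes>\<^bsub>H\<^esub> f y = g \<otimes>\<^bsub>H\<^esub> f y \<otimes>\<^bsub>H\<^esub> f (inv\<^bsub>H\<^esub> g))
    \<longleftrightarrow> (\<forall>z\<in>carrier H. \<exists>g\<in>carrier H. z = g \<otimes>\<^bsub>H\<^esub> f y \<otimes>\<^bsub>H\<^esub> f (inv\<^bsub>H\<^esub> g))"
    (is "(\<forall>z\<in>_. ?P (z \<otimes>\<^bsub>H\<^esub> f y)) \<longleftrightarrow> (\<forall>z\<in>_. ?P z)")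
  proof (intro iffI ballI)
    fix z assume a: "\<forall>z\<in>carrier H. ?P (z \<otimes>\<^bsub>H\<^esub> f y)" and z: "z \<in> carrier H"
    have zy: "z \<otimes>\<^bsub>H\<^esub> inv\<^bsub>H\<^esub> (f y) \<in> carrier H"
      by (intro coords.m_closed z coords.inv_closed fy)
    have "z \<otimes>\<^bsub>H\<^esub> inv\<^bsub>H\<^esub> (f y) \<otimes>\<^bsub>H\<^esub> f y = z"
      using z fy by (simp add: coords.m_assoc del: H_simps)
    with bspec[OF a zy] show "?P z" by (simp only:)
  next
    fix z assume a: "\<forall>z\<in>carrier H. ?P z" and z: "z \<in> carrier H"
    show "?P (z \<otimes>\<^bsub>H\<^esub> f y)" by (rule bspec[OF a coords.m_closed[OF z fy]])
  qed
  then show ?thesis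
    using reidemeister_one_iff[OF hom, of "\<one>\<^bsub>H\<^esub>"] reidemeister_one_iff[OF f, of "f y"] fy coords.one_closed *
    by simp
qed

end

theorem theorem2p15:
  fixes n :: nat
    and G T U :: "'k::alg_closed_field mat set"
    and \<Phi> \<Delta> :: "'v::euclidean_space set"
    and rs :: "'v list"
    and ev :: "'v \<Rightarrow> 'k mat \<Rightarrow> 'k"
    and x :: "'v \<Rightarrow> 'k \<Rightarrow> 'k mat"
    and c :: "'v \<Rightarrow> 'v \<Rightarrow> nat \<Rightarrow> nat \<Rightarrow> int"
    and \<psi> \<phi> \<phi>\<^sub>\<rho> \<phi>\<^sub>\<chi> \<phi>\<^sub>\<omega> \<phi>\<^sub>C :: "'k mat \<Rightarrow> 'k mat"
    and y :: "'k mat"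
    and \<rho> :: "'v \<Rightarrow> 'v"
    and \<chi> :: "'v \<Rightarrow> 'k"
  assumes char: "CHAR('k) \<noteq> 2" "CHAR('k) \<noteq> 3"
    and G: "simple_algebraic_group n G"
    and chevalley: "chevalley_group n G T \<Phi> ev x c"
    and simple: "simple_roots \<Phi> \<Delta>"
    and not_A2: "\<not> type_A 2 \<Delta>"
    and ordering: "root_ordering \<Phi> \<Delta> rs"
    and U: "maximal_unipotent_subgroup n G U" "positive_unipotent n x rs U"
    and \<psi>: "\<psi> \<in> Aut_alg n U"
    and y: "y \<in> U"
    and \<phi>: "compose U \<psi> (inner_aut n U y) = \<phi>"
    and decomposition: "\<phi> = compose U \<phi>\<^sub>\<rho> (compose U \<phi>\<^sub>\<chi> (compose U \<phi>\<^sub>\<omega> \<phi>\<^sub>C))"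
    and graph: "diagram_symmetry \<Phi> \<Delta> \<rho>" "graph_automorphism n x rs U \<rho> \<phi>\<^sub>\<rho>"
    and diagonal: "lattice_hom \<Phi> \<chi>" "diagonal_automorphism n x rs U \<chi> \<phi>\<^sub>\<chi>"
    and extremal: "\<phi>\<^sub>\<omega> \<in> extremal_automorphisms n \<Phi> \<Delta> x c rs U"
    and central: "central_automorphism n x \<Delta> rs U \<phi>\<^sub>C"
  shows "(reidemeister_number n U \<psi> = 1 \<longleftrightarrow> reidemeister_number n U \<phi> = 1) \<and>
         (reidemeister_number n U \<phi> = 1 \<longleftrightarrow> invertible_mat (automorphism_matrix \<Delta> rs \<rho> \<chi>))"
proof -
  have subU: "subgroup U (GL n)"
    using U(1) by (simp add: maximal_unipotent_subgroup_def unipotent_subgroup_def closed_subgroup_def)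
  have irr: "irreducible_root_system \<Phi>" using chevalley by (simp add: chevalley_group_def)
  interpret C: chevalley_unipotent \<Phi> \<Delta> n G T U rs ev x c
    by (intro chevalley_unipotent.intro based_root_system.intro chevalley_unipotent_axioms.intro
      irr simple subU chevalley not_A2 ordering U(2))
  have \<psi>_hom: "\<psi> \<in> hom C.H C.H" using \<psi> by (simp add: Aut_alg_def auto_def C.H_def)
  \<comment> \<open>Obtained from \<psi> and the inner automorphism, not from the four
    factors.\<close>
  have \<phi>_hom: "\<phi> \<in> hom C.H C.H"
    using C.coords.hom_compose[OF C.inner_aut_hom[OF y] \<psi>_hom] \<phi> by simp
  have root: "\<exists>w\<in>C.coords.V (Suc (C.hgt i)). \<phi> (x i t) = x (\<rho> i) (\<chi> i * t) \<otimes>\<^bsub>C.H\<^esub> w"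
    if i: "i \<in> set rs" for i t
  proof -
    obtain u where u: "u \<in> C.coords.V (Suc (C.hgt i))" "\<phi>\<^sub>C (x i t) = x i t \<otimes>\<^bsub>C.H\<^esub> u"
      using C.central_automorphism_root[OF central i] by blast
    obtain v where v: "v \<in> C.coords.V (Suc (C.hgt i))" "\<phi>\<^sub>\<omega> (\<phi>\<^sub>C (x i t)) = x i t \<otimes>\<^bsub>C.H\<^esub> v"
      using C.coords.unitriangular_coset[OF C.extremal_automorphism_unitriangular[OF extremal] i u(1)] u(2)
      by metis
    have "\<phi> (x i t) = \<phi>\<^sub>\<rho> (\<phi>\<^sub>\<chi> (x i t \<otimes>\<^bsub>C.H\<^esub> v))"
      unfolding decomposition using C.root_in_U[OF i] v(2) by (simp add: compose_eq)
    then show ?thesis using C.graph_diagonal_root[OF graph diagonal(2) i v(1), of t] by metis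
  qed
  interpret E: graded_endomorphism C.H rs C.hgt x \<phi> \<rho> \<chi>
    by unfold_locales (use \<phi>_hom root C.symmetry_height[OF graph(1)] in auto)
  have M: "height_matrix \<Delta> rs \<rho> \<chi> (real h) = E.M h" for h
  proof -
    have f: "filter (\<lambda>\<alpha>. ht \<Delta> \<alpha> = real h) rs = C.coords.L h"
      by (rule filter_cong) (auto simp: C.ht_eq_hgt)
    \<comment> \<open>\<open>height_matrix\<close> separates fixed from moved roots,
      \<open>E.P\<close> does not. Injectivity of \<rho> reconciles them: in the row of a fixed root
      no other column can contribute.\<close>
    have inj: "\<rho> (C.coords.L h ! i) = \<rho> (C.coords.L h ! j) \<longleftrightarrow> i = j"
      if "i < length (C.coords.L h)" "j < length (C.coords.L h)" for i j
    proof -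
      have "C.coords.L h ! i \<in> set rs" "C.coords.L h ! j \<in> set rs"
        using nth_mem[OF that(1)] nth_mem[OF that(2)] by auto
      then show ?thesis
        using C.symmetry_inj[OF graph(1)] that C.distinct_roots
        by (simp add: inj_on_eq_iff nth_eq_iff_index_eq)
    qed
    show ?thesis
      unfolding height_matrix_def Let_def f
    proof (rule eq_matI)
      fix i j assume "i < dim_row (E.M h)" "j < dim_col (E.M h)"
      then have ij: "i < length (C.coords.L h)" "j < length (C.coords.L h)"
        using E.M_carrier[of h] by auto
      show "mat (length (C.coords.L h)) (length (C.coords.L h)) (\<lambda>(i, j).
          if \<rho> (C.coords.L h ! i) = C.coords.L h ! i then (if j = i then \<chi> (C.coords.L h ! i) - 1 else 0)
          else if j = i then -1
          else if \<rho> (C.coords.L h ! j) = C.coords.L h ! i then \<chi> (C.coords.L h ! j) else 0) $$ (i, j)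
        = E.M h $$ (i, j)"
        using ij inj[OF ij] inj[OF ij(2,1)] by (auto simp: E.M_def E.P_def)
    qed (use E.M_carrier[of h] in auto)
  qed
  have sq: "square_mat (height_matrix \<Delta> rs \<rho> \<chi> h)" for h
    by (simp add: height_matrix_def Let_def square_mat.simps)
  have "automorphism_matrix \<Delta> rs \<rho> \<chi> \<in> carrier_mat (dim_row (automorphism_matrix \<Delta> rs \<rho> \<chi>)) (dim_row (automorphism_matrix \<Delta> rs \<rho> \<chi>))"
    using diag_block_mat_square[of "map (height_matrix \<Delta> rs \<rho> \<chi>) (sorted_list_of_set (ht \<Delta> ` set rs))"] sq
    by (auto simp: automorphism_matrix_def square_mat.simps)
  then have "invertible_mat (automorphism_matrix \<Delta> rs \<rho> \<chi>) \<longleftrightarrow> det (automorphism_matrix \<Delta> rs \<rho> \<chi>) \<noteq> 0"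
    by (rule invertible_mat_iff_det)
  also have "\<dots> \<longleftrightarrow> (\<forall>h\<in>ht \<Delta> ` set rs. det (height_matrix \<Delta> rs \<rho> \<chi> h) \<noteq> 0)"
    unfolding automorphism_matrix_def using sq
    by (subst det_diag_block_mat) (auto simp: prod_list_zero_iff)
  also have "\<dots> \<longleftrightarrow> (\<forall>i\<in>set rs. det (E.M (C.hgt i)) \<noteq> 0)"
    by (simp add: C.ht_eq_hgt M)
  also have "\<dots> \<longleftrightarrow> (\<forall>h. det (E.M h) \<noteq> 0)"
  proof (intro iffI allI ballI)
    fix h assume a: "\<forall>i\<in>set rs. det (E.M (C.hgt i)) \<noteq> 0"
    show "det (E.M h) \<noteq> 0"
    \<comment> \<open>At a height without roots the matrix is 0 by 0 and has determinant 1, so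
      heights that do not occur in \<open>rs\<close> impose no condition.\<close>
    proof (cases "C.coords.L h = []")
      case True
      then have "E.M h \<in> carrier_mat 0 0" using E.M_carrier[of h] by simp
      then show ?thesis by (simp add: det_dim_zero)
    next
      case False
      then obtain i where "i \<in> set rs" "C.hgt i = h" by (auto simp: filter_empty_conv)
      then show ?thesis using a by auto
    qed
  qed blast
  also have "\<dots> \<longleftrightarrow> reidemeister_number n U \<phi> = 1"
    using C.reidemeister_one_iff[OF \<phi>_hom, of "\<one>\<^bsub>C.H\<^esub>"] C.coords.one_closed C.coords.r_one
    unfolding E.twisted_transitive_iff[symmetric] by simp
  finally show ?thesis using C.reidemeister_inner[OF \<psi>_hom y] \<phi> by blast
qed

end
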